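(* Let $(\mathcal{S},\mathcal{A},\mathcal{P},r)$ be a weakly communicating average reward MDP with $r(s,a)\in[0,1]$ for all $(s,a)\in\mathcal{S}\times\mathcal{A}$. Let $Q^*$ be any solution of Bellman's equation $Q^*=\mathcal{T}(Q^* )-g^*$, let $h^*=\max_{\mathcal{A}}(Q^* )$, and assume $\|h^*\|_{\mathrm{sp}}\ge1$. Let $0<\varepsilon\le1$, $\delta\in(0,1)$, and let $(Q^N,T^N,\pi^N)$ be the output of $\mathrm{SAVIA}\textbf{+}(Q^0,\varepsilon/16,\delta)$ with $Q^0=0$, run with $c_k=5(k+2)\ln^2(k+2)$ and $\beta_k=k/(k+2)$. Then, with probability at least $1-\delta$, we have for all $s\in\mathcal{S}$ $$g^*-g_{\pi^N}(s)\le\|Q^N-\mathcal{T}(Q^N)\|_{\mathrm{sp}}\le\varepsilon,$$ with sample and time complexity $$O\big(\widetilde{L}\,|\mathcal{S}||\mathcal{A}|\,\|h^*\|_{\mathrm{sp}}^2/\varepsilon^2\big),\qquad \widetilde{L}=\ln\!\big(|\mathcal{S}||\mathcal{A}|\|h^*\|_{\mathrm{sp}}/(\varepsilon\delta)\big)\,\ln^4\!\big(\|h^*\|_{\mathrm{sp}}/\varepsilon\big).$$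
   Context: An average reward MDP $(\mathcal{S},\mathcal{A},\mathcal{P},r)$ has finite state space $\mathcal{S}$, finite action space $\mathcal{A}$, transition kernel $\mathcal{P}$ (each $\mathcal{P}(\cdot|s,a)$ is a probability distribution on $\mathcal{S}$) and reward $r:\mathcal{S}\times\mathcal{A}\to\mathbb{R}$. A policy is a map $\pi:\mathcal{S}\to\mathcal{A}$, with gain $g_\pi(s)=\lim_{n\to\infty}\mathbb{E}_\pi\big[\frac1n\sum_{t=0}^{n-1}r(s_t,a_t)|s_0=s\big]$, where $a_t=\pi(s_t)$, $s_{t+1}\sim\mathcal{P}(\cdot|s_t,a_t)$. The optimal gain is $g^*(s)=\max_\pi g_\pi(s)$. The MDP is weakly communicating if there is a set of states such that each state of the set is accessible from every other state of the set under some policy, and all remaining states (possibly none) are transient under every policy; then $g^*(s)\equiv g^*\in\mathbb{R}$ is constant. Notation: $\|x\|_{\mathrm{sp}}=\max_jx(j)-\min_jx(j)$. $\max_{\mathcal{A}}(Q)(s)=\max_{a}Q(s,a)$. $\mathcal{T}(Q)(s,a)=r(s,a)+\sum_{s'}\mathcal{P}(s'|s,a)\max_{\mathcal{A}}(Q)(s')$. The Bellman equation $Q=\mathcal{T}(Q)-g^*$ always has solutions. $O(\cdot)$ hides an absolute constant factor. Subroutine $\mathrm{SAMPLE}(d,m)$, $d\in\mathbb{R}^{\mathcal{S}}$, $m\ge1$ integer: for each $(s,a)$ draw $m$ fresh i.i.d. samples $s_1,\dots,s_m\sim\mathcal{P}(\cdot|s,a)$ (independent of the past) and return the matrix $D(s,a)=\frac1m\sum_{j=1}^m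 d(s_j)$. It uses $|\mathcal{S}||\mathcal{A}|m$ samples. Algorithm $\mathrm{SAVIA}(Q^0,n,\varepsilon,\delta)$ (with sequences $c_k,\beta_k$): set $\alpha=\ln(2|\mathcal{S}||\mathcal{A}|(n+1)/\delta)$, $T^{-1}=r$, $h^{-1}=0$, $\beta_0=0$. For $k=0,\dots,n$: $Q^k=(1-\beta_k)Q^0+\beta_kT^{k-1}$; $h^k=\max_{\mathcal{A}}(Q^k)$; $d^k=h^k-h^{k-1}$; $m_k=\max\{\lceil\alpha c_k\|d^k\|_{\mathrm{sp}}^2/\varepsilon^2\rceil,1\}$; $D^k=\mathrm{SAMPLE}(d^k,m_k)$; $T^k=T^{k-1}+D^k$. Finally choose $\pi^n(s)\in\operatorname{argmax}_aQ^n(s,a)$ and output $(Q^n,T^n,\pi^n)$. Algorithm $\mathrm{SAVIA}\textbf{+}(Q^0,\varepsilon,\delta)$: for $i=0,1,2,\dots$ set $n_i=2^i$, $\delta_i=\delta/c_i$, and run $\mathrm{SAVIA}(Q^0,n_i,\varepsilon,\delta_i)$ afresh (with samples independent of earlier loops) to get $(Q^{n_i},T^{n_i},\pi^{n_i})$; stop at the first $i$ with $\|Q^{n_i}-T^{n_i}\|_{\mathrm{sp}}\le14\varepsilon$ and output $(Q^{n_i},T^{n_i},\pi^{n_i})$, denoted $(Q^N,T^N,\pi^N)$ with $N=n_i$ for this $i$. (In the claim the algorithm is called with $\varepsilon/16$ in place of $\varepsilon$.) Sample complexity is the total number of samples drawn over all loops until stopping; time complexity is the running time under the convention that each sample costs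 $O(1)$ time, so that it is of the same order as the sample complexity.
   Formalization: The factor ln^4(||h*||_sp/ε) in the complexity bound is replaced by max(1, ln(||h*||_sp/ε))^4, because the literal factor vanishes at ||h*||_sp = ε = 1 while at least |S||A| samples are always drawn. *)

theory Defs
  imports "HOL-Probability.Probability"
begin

section \<open>Finite average reward MDPs\<close>

text \<open>
  States and actions are finite carrier sets rather than finite types, so that one constant can be
  chosen uniformly in the numbers of states and actions.  Only the values of functions on the
  carriers are relevant.
\<close>

record ('s, 'a) mdp =
  states :: "'s set"
  actions :: "'a set"
  kernel :: "'s \<Rightarrow> 'a \<Rightarrow> 's pmf"
  reward :: "'s \<Rightarrow> 'a \<Rightarrow> real"

definition finite_mdp :: "('s, 'a) mdp \<Rightarrow> bool" where
  "finite_mdp M \<longleftrightarrow>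
     finite (states M) \<and> states M \<noteq> {} \<and> finite (actions M) \<and> actions M \<noteq> {} \<and>
     (\<forall>s\<in>states M. \<forall>a\<in>actions M. set_pmf (kernel M s a) \<subseteq> states M)"

definition policies :: "('s, 'a) mdp \<Rightarrow> ('s \<Rightarrow> 'a) set" where
  "policies M = states M \<rightarrow>\<^sub>E actions M"

text \<open>Joint law of the first \<open>n\<close> states \<open>[s\<^sub>0, \<dots>, s\<^sub>n\<^sub>-\<^sub>1]\<close> visited from \<open>s\<^sub>0 = s\<close>.\<close>

primrec traj :: "('s, 'a) mdp \<Rightarrow> ('s \<Rightarrow> 'a) \<Rightarrow> nat \<Rightarrow> 's \<Rightarrow> 's list pmf" where
  "traj M \<pi> 0 s = return_pmf []"
| "traj M \<pi> (Suc n) s = bind_pmf (kernel M s (\<pi> s)) (\<lambda>s'. map_pmf ((#) s) (traj M \<pi> n s'))"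

definition gain :: "('s, 'a) mdp \<Rightarrow> ('s \<Rightarrow> 'a) \<Rightarrow> 's \<Rightarrow> real" where
  "gain M \<pi> s = lim (\<lambda>n. measure_pmf.expectation (traj M \<pi> n s)
     (\<lambda>xs. (1 / real n) * (\<Sum>t<n. reward M (xs ! t) (\<pi> (xs ! t)))))"

definition opt_gain :: "('s, 'a) mdp \<Rightarrow> 's \<Rightarrow> real" where
  "opt_gain M s = Max ((\<lambda>\<pi>. gain M \<pi> s) ` policies M)"

definition accessible :: "('s, 'a) mdp \<Rightarrow> ('s \<Rightarrow> 'a) \<Rightarrow> 's \<Rightarrow> 's \<Rightarrow> bool" where
  "accessible M \<pi> s s' \<longleftrightarrow>
     (\<exists>t. measure_pmf.prob (traj M \<pi> (Suc t) s) {xs. xs ! t = s'} > 0)"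

text \<open>
  The probability of ever returning to the initial state, as the increasing limit of the
  probabilities of returning at one of the times \<open>1, \<dots>, n - 1\<close>.
\<close>

definition return_prob :: "('s, 'a) mdp \<Rightarrow> ('s \<Rightarrow> 'a) \<Rightarrow> 's \<Rightarrow> real" where
  "return_prob M \<pi> s = (SUP n. measure_pmf.prob (traj M \<pi> n s) {xs. s \<in> set (tl xs)})"

definition transient :: "('s, 'a) mdp \<Rightarrow> ('s \<Rightarrow> 'a) \<Rightarrow> 's \<Rightarrow> bool" where
  "transient M \<pi> s \<longleftrightarrow> return_prob M \<pi> s < 1"

definition weakly_communicating :: "('s, 'a) mdp \<Rightarrow> bool" where
  "weakly_communicating M \<longleftrightarrow>
     (\<exists>C\<subseteq>states M.
        (\<forall>s\<in>C. \<forall>s'\<in>C. s \<noteq> s' \<longrightarrow> (\<exists>\<pi>\<in>policies M. accessible M \<pi> s s')) \<and>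
        (\<forall>s\<in>states M - C. \<forall>\<pi>\<in>policies M. transient M \<pi> s))"


section \<open>Span seminorm and Bellman operator\<close>

definition sp_norm :: "'i set \<Rightarrow> ('i \<Rightarrow> real) \<Rightarrow> real" where
  "sp_norm I x = Max (x ` I) - Min (x ` I)"

definition sp_state :: "('s, 'a) mdp \<Rightarrow> ('s \<Rightarrow> real) \<Rightarrow> real" where
  "sp_state M h = sp_norm (states M) h"

definition sp_mat :: "('s, 'a) mdp \<Rightarrow> ('s \<Rightarrow> 'a \<Rightarrow> real) \<Rightarrow> real" where
  "sp_mat M Q = sp_norm (states M \<times> actions M) (\<lambda>(s, a). Q s a)"

definition max_act :: "('s, 'a) mdp \<Rightarrow> ('s \<Rightarrow> 'a \<Rightarrow> real) \<Rightarrow> 's \<Rightarrow> real" where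
  "max_act M Q s = Max (Q s ` actions M)"

definition bellman :: "('s, 'a) mdp \<Rightarrow> ('s \<Rightarrow> 'a \<Rightarrow> real) \<Rightarrow> 's \<Rightarrow> 'a \<Rightarrow> real" where
  "bellman M Q s a = reward M s a + (\<Sum>s'\<in>states M. pmf (kernel M s a) s' * max_act M Q s')"

text \<open>
  The equation \<open>Q = \<T>(Q) - g\<^sup>*\<close>; for weakly communicating \<open>M\<close> the function
  \<open>opt_gain M\<close> is constant on the states.
\<close>

definition bellman_solution :: "('s, 'a) mdp \<Rightarrow> ('s \<Rightarrow> 'a \<Rightarrow> real) \<Rightarrow> bool" where
  "bellman_solution M Q \<longleftrightarrow>
     (\<forall>s\<in>states M. \<forall>a\<in>actions M. Q s a = bellman M Q s a - opt_gain M s)"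

definition greedy_policies :: "('s, 'a) mdp \<Rightarrow> ('s \<Rightarrow> 'a \<Rightarrow> real) \<Rightarrow> ('s \<Rightarrow> 'a) set" where
  "greedy_policies M Q =
     {\<pi> \<in> policies M. \<forall>s\<in>states M. \<forall>a\<in>actions M. Q s a \<le> Q s (\<pi> s)}"


section \<open>The algorithms\<close>

definition sample :: "('s, 'a) mdp \<Rightarrow> ('s \<Rightarrow> real) \<Rightarrow> nat \<Rightarrow> ('s \<Rightarrow> 'a \<Rightarrow> real) pmf" where
  "sample M d m =
     map_pmf (\<lambda>X s a. (1 / real m) * (\<Sum>j<m. d (X (s, a, j))))
       (Pi_pmf (states M \<times> actions M \<times> {..<m}) undefined (\<lambda>(s, a, j). kernel M s a))"

text \<open>
  \<open>savia_iter \<dots> k\<close> is the law of \<open>(Q, h, T, N)\<close> after the iterations \<open>0, \<dots>, k - 1\<close>, where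
  \<open>N\<close> counts the samples drawn so far; the next iteration sees \<open>h\<close> and \<open>T\<close> as
  \<open>h\<^sup>k\<^sup>-\<^sup>1\<close> and \<open>T\<^sup>k\<^sup>-\<^sup>1\<close>.  The initial first component is never read.
\<close>

primrec savia_iter ::
  "('s, 'a) mdp \<Rightarrow> (nat \<Rightarrow> real) \<Rightarrow> (nat \<Rightarrow> real) \<Rightarrow> ('s \<Rightarrow> 'a \<Rightarrow> real) \<Rightarrow> real \<Rightarrow> real \<Rightarrow>
   nat \<Rightarrow> (('s \<Rightarrow> 'a \<Rightarrow> real) \<times> ('s \<Rightarrow> real) \<times> ('s \<Rightarrow> 'a \<Rightarrow> real) \<times> nat) pmf" where
  "savia_iter M c \<beta> Q0 \<epsilon> \<alpha> 0 = return_pmf (Q0, (\<lambda>s. 0), reward M, 0)"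
| "savia_iter M c \<beta> Q0 \<epsilon> \<alpha> (Suc k) =
     bind_pmf (savia_iter M c \<beta> Q0 \<epsilon> \<alpha> k) (\<lambda>(_, h', T', N).
       let b = (if k = 0 then 0 else \<beta> k);
           Q = (\<lambda>s a. (1 - b) * Q0 s a + b * T' s a);
           h = max_act M Q;
           d = (\<lambda>s. h s - h' s);
           m = max (nat \<lceil>\<alpha> * c k * (sp_state M d)\<^sup>2 / \<epsilon>\<^sup>2\<rceil>) 1
       in map_pmf (\<lambda>D. (Q, h, (\<lambda>s a. T' s a + D s a), N + card (states M) * card (actions M) * m))
            (sample M d m))"

text \<open>
  The rule \<open>pick\<close> selects the greedy policy.  The last component of the result is the number
  of samples used.
\<close>

definition savia ::
  "('s, 'a) mdp \<Rightarrow> (nat \<Rightarrow> real) \<Rightarrow> (nat \<Rightarrow> real) \<Rightarrow> (('s \<Rightarrow> 'a \<Rightarrow> real) \<Rightarrow> 's \<Rightarrow> 'a) \<Rightarrow>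
   ('s \<Rightarrow> 'a \<Rightarrow> real) \<Rightarrow> nat \<Rightarrow> real \<Rightarrow> real \<Rightarrow>
   (('s \<Rightarrow> 'a \<Rightarrow> real) \<times> ('s \<Rightarrow> 'a \<Rightarrow> real) \<times> ('s \<Rightarrow> 'a) \<times> nat) pmf" where
  "savia M c \<beta> pick Q0 n \<epsilon> \<delta> =
     (let \<alpha> = ln (2 * real (card (states M)) * real (card (actions M)) * (real n + 1) / \<delta>)
      in map_pmf (\<lambda>(Q, h, T, N). (Q, T, pick Q, N)) (savia_iter M c \<beta> Q0 \<epsilon> \<alpha> (n + 1)))"

text \<open>
  The outer loop, entered at index \<open>i\<close> after \<open>N\<close> samples.  A run that never
  stops contributes no mass to the resulting sub-probability distribution.
\<close>

partial_function (spmf) savia_plus_loop ::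
  "('s, 'a) mdp \<Rightarrow> (nat \<Rightarrow> real) \<Rightarrow> (nat \<Rightarrow> real) \<Rightarrow> (('s \<Rightarrow> 'a \<Rightarrow> real) \<Rightarrow> 's \<Rightarrow> 'a) \<Rightarrow>
   ('s \<Rightarrow> 'a \<Rightarrow> real) \<Rightarrow> real \<Rightarrow> real \<Rightarrow> nat \<Rightarrow> nat \<Rightarrow>
   (('s \<Rightarrow> 'a \<Rightarrow> real) \<times> ('s \<Rightarrow> 'a \<Rightarrow> real) \<times> ('s \<Rightarrow> 'a) \<times> nat) spmf" where
  "savia_plus_loop M c \<beta> pick Q0 \<epsilon> \<delta> i N =
     bind_spmf (spmf_of_pmf (savia M c \<beta> pick Q0 (2 ^ i) \<epsilon> (\<delta> / c i))) (\<lambda>(Q, T, \<pi>, m).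
       if sp_mat M (\<lambda>s a. Q s a - T s a) \<le> 14 * \<epsilon>
       then return_spmf (Q, T, \<pi>, N + m)
       else savia_plus_loop M c \<beta> pick Q0 \<epsilon> \<delta> (i + 1) (N + m))"

definition savia_plus ::
  "('s, 'a) mdp \<Rightarrow> (nat \<Rightarrow> real) \<Rightarrow> (nat \<Rightarrow> real) \<Rightarrow> (('s \<Rightarrow> 'a \<Rightarrow> real) \<Rightarrow> 's \<Rightarrow> 'a) \<Rightarrow>
   ('s \<Rightarrow> 'a \<Rightarrow> real) \<Rightarrow> real \<Rightarrow> real \<Rightarrow>
   (('s \<Rightarrow> 'a \<Rightarrow> real) \<times> ('s \<Rightarrow> 'a \<Rightarrow> real) \<times> ('s \<Rightarrow> 'a) \<times> nat) spmf" where
  "savia_plus M c \<beta> pick Q0 \<epsilon> \<delta> = savia_plus_loop M c \<beta> pick Q0 \<epsilon> \<delta> 0 0"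

text \<open>
  Running time is charged to the samples: the \<open>j\<close>-th sample drawn costs \<open>cost j\<close>, which also
  pays for the arithmetic (every iteration draws at least one sample per state-action pair).
\<close>

definition run_time :: "(nat \<Rightarrow> real) \<Rightarrow> nat \<Rightarrow> real" where
  "run_time cost N = (\<Sum>j<N. cost j)"

definition c_seq :: "nat \<Rightarrow> real" where
  "c_seq k = 5 * (real k + 2) * (ln (real k + 2))\<^sup>2"

definition \<beta>_seq :: "nat \<Rightarrow> real" where
  "\<beta>_seq k = real k / (real k + 2)"

text \<open>
  The rate \<open>L |\<S>| |\<A>| H\<^sup>2 / \<epsilon>\<^sup>2\<close> with \<open>H\<close> the span of \<open>h\<^sup>*\<close>.  The factor
  \<open>ln\<^sup>4 (H / \<epsilon>)\<close> is read as bounded below by a constant: it vanishes at \<open>H = \<epsilon> = 1\<close>,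
  whereas every run draws at least \<open>|\<S>| |\<A>|\<close> samples.
\<close>

definition complexity_rate :: "('s, 'a) mdp \<Rightarrow> real \<Rightarrow> real \<Rightarrow> real \<Rightarrow> real" where
  "complexity_rate M H \<epsilon> \<delta> =
     (let SA = real (card (states M)) * real (card (actions M));
          L = ln (SA * H / (\<epsilon> * \<delta>)) * (max 1 (ln (H / \<epsilon>))) ^ 4
      in L * SA * H\<^sup>2 / \<epsilon>\<^sup>2)"

end

(*
  Let T^k approximate T(Q^k); the sampling error T^k - T(Q^k) is a sum of martingale differences,
  and the batch sizes m_k make its conditional sub-Gaussian constants summable, so Hoeffding's lemma
  and a union bound over k, s, a keep it below epsilon on the whole run.  On that event the iteration
  Q^k = beta_k T^(k-1) is a Halpern iteration of a nonexpansive map perturbed by epsilon.  Anchoring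
  keeps Q^k within span distance O(H + k epsilon) of Q*, and the recursion for the increments gives
  sp(d^k) <= 8 H / (k + 2) + epsilon.  Hence a run of length n >= 2 H / epsilon passes the stopping
  test, and a run up to that length draws O(alpha H^2 ln^3(n + 2) / epsilon^2) samples per pair.
  The test bounds sp(Q - T(Q)), which in turn bounds the gain gap of the greedy policy.  The only use
  of weak communication is that the optimal gain is constant.
*)
theory Submission
  imports Defs
begin

section \<open>Finite Markov chains\<close>

text \<open>The span seminorm ignores additive constants, so the unknown gain drops out of every
  comparison with a Bellman solution; the price is that the Bellman operator need not contract, and
  only the anchor at 0 keeps the iterates from drifting. The batch sizes depend on past samples, so
  no inequality for a fixed sample size applies directly; instead m_k is just large enough to give
  the conditional exponential moment of each increment a deterministic bound. The sequence c_k
  serves twice, as weights of the batch sizes and to divide \<delta> among the loops, both times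
  through the sum of 1 / c_k being at most 1. Four logarithms arise: two from c_k, one from the
  harmonic sum of the increments, one from the number of loops. The precision \<epsilon> / 16 pays
  for the threshold 14 plus 2 for the span of a sampling error bounded by 1. The gain is a limit and
  transience a return probability, so constancy of the optimal gain first needs existence of
  long-run averages and of recurrent states.\<close>

text \<open>Bolzano-Weierstrass one coordinate at a time: each new coordinate passes to a further
  subsequence, which preserves the limits already found.\<close>

lemma convergent_subsequence_finite:
  fixes a :: "nat \<Rightarrow> 's \<Rightarrow> real"
  assumes "finite S" and "\<And>n s. s \<in> S \<Longrightarrow> \<bar>a n s\<bar> \<le> R"
  shows "\<exists>\<phi> x. strict_mono \<phi> \<and> (\<forall>s\<in>S. (\<lambda>n. a (\<phi> n) s) \<longlonglongrightarrow> x s)"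
  using assms
proof (induction S rule: finite_induct)
  case empty
  then show ?case using strict_mono_id by blast
next
  case (insert s S)
  then obtain \<phi> x where \<phi>: "strict_mono \<phi>" "\<forall>s\<in>S. (\<lambda>n. a (\<phi> n) s) \<longlonglongrightarrow> x s"
    by auto
  have "bounded (range (\<lambda>n. a (\<phi> n) s))"
    using insert.prems by (auto intro!: boundedI[where B = R])
  from bounded_imp_convergent_subsequence[OF this]
  obtain l \<psi> where \<psi>: "strict_mono \<psi>" "((\<lambda>n. a (\<phi> n) s) \<circ> \<psi>) \<longlonglongrightarrow> l"
    by blast
  have "(\<lambda>n. a (\<phi> (\<psi> n)) t) \<longlonglongrightarrow> (x(s := l)) t" if "t \<in> insert s S" for t
  proof (cases "t = s")
    case True
    then show ?thesis using \<psi>(2) by (simp add: o_def)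
  next
    case False
    then have "(\<lambda>n. a (\<phi> n) t) \<longlonglongrightarrow> x t" using \<phi>(2) that by auto
    from LIMSEQ_subseq_LIMSEQ[OF this \<psi>(1)] show ?thesis using False by (simp add: o_def)
  qed
  moreover have "strict_mono (\<lambda>n. \<phi> (\<psi> n))"
    using strict_mono_o[OF \<phi>(1) \<psi>(1)] by (simp add: o_def)
  ultimately show ?case by blast
qed

locale finite_chain =
  fixes S :: "'s set" and p :: "'s \<Rightarrow> 's \<Rightarrow> real"
  assumes fin: "finite S" and nonempty: "S \<noteq> {}"
    and nonneg: "\<And>s t. 0 \<le> p s t"
    and stochastic: "\<And>s. s \<in> S \<Longrightarrow> (\<Sum>t\<in>S. p s t) = 1"
begin

definition step :: "('s \<Rightarrow> real) \<Rightarrow> 's \<Rightarrow> real" where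
  "step f s = (\<Sum>t\<in>S. p s t * f t)"

text \<open>The expected reward collected in n stages, unrolled at the first transition so that it
  matches the recursion of \<open>traj\<close>.\<close>

primrec total :: "('s \<Rightarrow> real) \<Rightarrow> nat \<Rightarrow> 's \<Rightarrow> real" where
  "total r 0 s = 0"
| "total r (Suc n) s = r s + step (total r n) s"

text \<open>The probability of seeing z among the first n states, the starting state included; hence
  \<open>step (hit z n) z\<close> is the probability of returning to z at one of the times 1, ...,
  n.\<close>

primrec hit :: "'s \<Rightarrow> nat \<Rightarrow> 's \<Rightarrow> real" where
  "hit z 0 s = 0"
| "hit z (Suc n) s = (if s = z then 1 else step (hit z n) s)"

definition closed_set :: "'s set \<Rightarrow> bool" where
  "closed_set U \<longleftrightarrow> U \<subseteq> S \<and> (\<forall>s\<in>U. \<forall>t\<in>S. 0 < p s t \<longrightarrow> t \<in> U)"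

lemma step_mono: "(\<And>t. t \<in> S \<Longrightarrow> f t \<le> g t) \<Longrightarrow> step f s \<le> step g s"
  unfolding step_def by (intro sum_mono mult_left_mono nonneg) auto

lemma step_cong: "(\<And>t. t \<in> S \<Longrightarrow> f t = g t) \<Longrightarrow> step f s = step g s"
  unfolding step_def by (intro sum.cong) auto

lemma step_const: "s \<in> S \<Longrightarrow> step (\<lambda>_. c) s = c"
  unfolding step_def by (simp add: stochastic flip: sum_distrib_right)

lemma step_add: "step (\<lambda>t. f t + g t) s = step f s + step g s"
  unfolding step_def by (simp add: algebra_simps sum.distrib)

lemma step_diff: "step (\<lambda>t. f t - g t) s = step f s - step g s"
  unfolding step_def by (simp add: algebra_simps sum_subtractf)

lemma step_mult: "step (\<lambda>t. c * f t) s = c * step f s"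
  unfolding step_def by (simp add: sum_distrib_left mult_ac)

lemma step_sum: "step (\<lambda>t. \<Sum>i\<in>I. f i t) s = (\<Sum>i\<in>I. step (f i) s)"
  unfolding step_def sum_distrib_left by (rule sum.swap)

lemma step_abs_le:
  assumes "s \<in> S" "\<And>t. t \<in> S \<Longrightarrow> \<bar>f t\<bar> \<le> c" shows "\<bar>step f s\<bar> \<le> c"
proof -
  have "step f s \<le> step (\<lambda>_. c) s"
    by (rule step_mono) (use assms(2) in \<open>simp add: abs_le_iff\<close>)
  moreover have "step (\<lambda>_. - c) s \<le> step f s"
    by (rule step_mono) (use assms(2) in \<open>fastforce simp: abs_le_iff\<close>)
  ultimately show ?thesis using assms(1) by (simp add: step_const)
qed

lemma step_tendsto:
  assumes "\<And>t. t \<in> S \<Longrightarrow> (\<lambda>n. f n t) \<longlonglongrightarrow> g t"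
  shows "(\<lambda>n. step (f n) s) \<longlonglongrightarrow> step g s"
  unfolding step_def by (intro tendsto_intros assms)

text \<open>The excesses f t - f s over the successors of s are nonnegative and have weighted sum
  zero, so each one of positive weight vanishes.\<close>

lemma minimum_principle:
  assumes "s \<in> S" "step f s = f s" "\<And>t. t \<in> S \<Longrightarrow> 0 < p s t \<Longrightarrow> f s \<le> f t"
    and "t \<in> S" "0 < p s t"
  shows "f t = f s"
proof -
  have "(\<Sum>t\<in>S. p s t * (f t - f s)) = step f s - step (\<lambda>_. f s) s"
    by (simp add: step_def algebra_simps sum_subtractf)
  also have "\<dots> = 0" using assms by (simp add: step_const)
  finally have "(\<Sum>t\<in>S. p s t * (f t - f s)) = 0" .
  moreover have "0 \<le> p s t * (f t - f s)" if "t \<in> S" for t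
    using assms(3)[OF that] nonneg[of s t] by (cases "p s t = 0") auto
  ultimately have "p s t * (f t - f s) = 0"
    using sum_nonneg_eq_0_iff[OF fin, of "\<lambda>t. p s t * (f t - f s)"] assms(4) by simp
  then show ?thesis using assms(5) by simp
qed

text \<open>The increment is the n-th iterate of \<open>step\<close> on r, an average of values of
  r.\<close>

lemma total_increment_abs_le:
  assumes "\<And>s. s \<in> S \<Longrightarrow> \<bar>r s\<bar> \<le> R"
  shows "s \<in> S \<Longrightarrow> \<bar>total r (Suc n) s - total r n s\<bar> \<le> R"
proof (induction n arbitrary: s)
  case 0
  then show ?case using assms by (simp add: step_def)
next
  case (Suc n)
  have "total r (Suc (Suc n)) s - total r (Suc n) s
      = step (\<lambda>t. total r (Suc n) t - total r n t) s"
    using total.simps(2)[of r "Suc n" s] total.simps(2)[of r n s]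
      step_diff[of "total r (Suc n)" "total r n" s] by linarith
  then show ?case using step_abs_le[OF Suc.prems Suc.IH] by simp
qed

lemma total_abs_le:
  assumes "\<And>s. s \<in> S \<Longrightarrow> \<bar>r s\<bar> \<le> R" "s \<in> S"
  shows "\<bar>total r n s\<bar> \<le> real n * R"
proof (induction n)
  case (Suc n)
  then show ?case using total_increment_abs_le[where r = r and R = R and n = n, OF assms]
    by (simp add: algebra_simps del: total.simps)
qed simp

text \<open>The deviation \<open>total r m - m x - y\<close> starts at -y, and its successor is e
  plus \<open>step\<close> of it: x is harmonic and the coboundary is absorbed by y. Only e
  accumulates.\<close>

lemma total_decomposition:
  assumes dec: "\<And>s. s \<in> S \<Longrightarrow> r s = x s + (y s - step y s) + e s"
    and har: "\<And>s. s \<in> S \<Longrightarrow> step x s = x s"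
    and Y: "\<And>s. s \<in> S \<Longrightarrow> \<bar>y s\<bar> \<le> Y" and e: "\<And>s. s \<in> S \<Longrightarrow> \<bar>e s\<bar> \<le> \<eta>"
  shows "s \<in> S \<Longrightarrow> \<bar>total r m s - real m * x s - y s\<bar> \<le> Y + real m * \<eta>"
proof (induction m arbitrary: s)
  case 0
  then show ?case using Y by simp
next
  case (Suc m)
  have "step (\<lambda>t. total r m t - real m * x t - y t) s
      = step (total r m) s - real m * x s - step y s"
    using har Suc.prems by (simp add: step_diff step_mult)
  then have "total r (Suc m) s - real (Suc m) * x s - y s
      = e s + step (\<lambda>t. total r m t - real m * x t - y t) s"
    using dec[OF Suc.prems] by (simp add: algebra_simps)
  moreover have "\<bar>step (\<lambda>t. total r m t - real m * x t - y t) s\<bar> \<le> Y + real m * \<eta>"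
    by (rule step_abs_le[OF Suc.prems Suc.IH])
  ultimately show ?case using e[OF Suc.prems] by (simp add: algebra_simps)
qed

text \<open>
  Mean ergodic theorem.  A subsequential limit \<open>x\<close> of the averages is harmonic, and
  \<open>r\<close> minus its \<open>n\<close>-th average is the coboundary \<open>y - step y\<close> of the mean \<open>y\<close> of
  \<open>total r 0, \<dots>, total r (n - 1)\<close>; hence \<open>r - x\<close> is a limit of coboundaries, whose
  averages vanish.
\<close>

theorem average_converges:
  "\<exists>x. (\<forall>s\<in>S. (\<lambda>n. total r n s / real n) \<longlonglongrightarrow> x s) \<and> (\<forall>s\<in>S. step x s = x s)"
proof -
  define R where "R = Max ((\<lambda>s. \<bar>r s\<bar>) ` S)"
  have R: "\<bar>r s\<bar> \<le> R" if "s \<in> S" for s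
    unfolding R_def using fin that by auto
  define a where "a n s = total r n s / real n" for n s
  have a_le: "\<bar>a n s\<bar> \<le> R" if "s \<in> S" for n s
  proof -
    have "0 \<le> R" using R[OF that] by linarith
    then show ?thesis using total_abs_le[where r = r and R = R and n = n, OF R that]
      by (cases "n = 0") (auto simp: a_def divide_simps mult.commute)
  qed
  obtain \<phi> x where \<phi>: "strict_mono \<phi>" and x: "\<And>s. s \<in> S \<Longrightarrow> (\<lambda>n. a (\<phi> n) s) \<longlonglongrightarrow> x s"
    using convergent_subsequence_finite[where a = a and R = R, OF fin a_le] by blast
  have \<phi>_top: "filterlim (\<lambda>n. real (\<phi> n)) at_top sequentially"
    by (rule filterlim_compose[OF filterlim_real_sequentially filterlim_subseq[OF \<phi>]])
  have har: "step x s = x s" if s: "s \<in> S" for s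
  proof -
    have "(\<lambda>n. step (a (\<phi> n)) s - a (\<phi> n) s) \<longlonglongrightarrow> step x s - x s"
      by (intro tendsto_diff step_tendsto x s)
    moreover have "(\<lambda>n. step (a (\<phi> n)) s - a (\<phi> n) s) \<longlonglongrightarrow> 0"
    proof (rule tendsto_0_le)
      show "(\<lambda>n. (2 * R) / real (\<phi> n)) \<longlonglongrightarrow> 0"
        by (rule real_tendsto_divide_at_top[OF tendsto_const \<phi>_top])
      \<comment> \<open>The recursion gives \<open>step (total r n) = total r (Suc n) - r\<close>,
        so an average is harmonic up to 2 R / n.\<close>
      have "norm (step (a n) s - a n s) \<le> norm ((2 * R) / real n) * 1" for n
      proof -
        have "step (a n) s = step (total r n) s / real n"
          unfolding a_def using step_mult[of "1 / real n" "total r n" s] by simp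
        then have "step (a n) s - a n s = (total r (Suc n) s - total r n s - r s) / real n"
          by (simp add: a_def diff_divide_distrib)
        moreover have "\<bar>total r (Suc n) s - total r n s - r s\<bar> \<le> 2 * R"
          using total_increment_abs_le[where r = r and R = R and n = n, OF R s] R[OF s] by linarith
        moreover have "\<bar>2 * R\<bar> = 2 * R" using R[OF s] by simp
        ultimately show ?thesis by (simp add: divide_right_mono del: total.simps)
      qed
      then show "\<forall>\<^sub>F n in sequentially.
          norm (step (a (\<phi> n)) s - a (\<phi> n) s) \<le> norm (2 * R / real (\<phi> n)) * 1" by simp
    qed
    ultimately have "step x s - x s = 0" by (rule LIMSEQ_unique)
    then show ?thesis by simp
  qed
  have "(\<lambda>m. a m s) \<longlonglongrightarrow> x s" if s: "s \<in> S" for s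
  proof (rule LIMSEQ_I)
    fix \<epsilon> :: real assume \<epsilon>: "0 < \<epsilon>"
    have "\<forall>\<^sub>F n in sequentially. \<forall>t\<in>S. \<bar>a (\<phi> n) t - x t\<bar> < \<epsilon> / 2"
      using tendstoD[OF x half_gt_zero[OF \<epsilon>]]
      by (intro eventually_ball_finite fin) (simp add: dist_real_def)
    moreover have "\<forall>\<^sub>F n in sequentially. 0 < \<phi> n"
      using filterlim_subseq[OF \<phi>] unfolding filterlim_at_top Suc_le_eq[symmetric] by blast
    ultimately have "\<forall>\<^sub>F n in sequentially. 0 < \<phi> n \<and> (\<forall>t\<in>S. \<bar>a (\<phi> n) t - x t\<bar> < \<epsilon> / 2)"
      by (rule eventually_elim2) blast
    then obtain k where "0 < \<phi> k" "\<forall>t\<in>S. \<bar>a (\<phi> k) t - x t\<bar> < \<epsilon> / 2"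
      using eventually_happens'[OF sequentially_bot] by blast
    \<comment> \<open>This n stays fixed as the horizon of y, while m tends to infinity.\<close>
    then obtain n where n: "n > 0" "\<And>t. t \<in> S \<Longrightarrow> \<bar>a n t - x t\<bar> \<le> \<epsilon> / 2"
      using less_imp_le by blast
    define y where "y t = (1 / real n) * (\<Sum>k<n. total r k t)" for t
    define Y where "Y = Max ((\<lambda>t. \<bar>y t\<bar>) ` S)"
    have Y: "\<bar>y t\<bar> \<le> Y" if "t \<in> S" for t unfolding Y_def using fin that by auto
    have dec: "r t = x t + (y t - step y t) + (a n t - x t)" for t
    proof -
      have "(\<Sum>k<n. total r k t - step (total r k) t)
          = (\<Sum>k<n. r t - (total r (Suc k) t - total r k t))"
        by (intro sum.cong) auto
      also have "\<dots> = real n * r t - total r n t"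
        using sum_lessThan_telescope[of "\<lambda>k. total r k t" n] by (simp add: sum_subtractf del: total.simps(2))
      finally have "y t - step y t = (1 / real n) * (real n * r t - total r n t)"
        by (simp only: y_def[abs_def] step_mult step_sum sum_subtractf right_diff_distrib[symmetric])
      then show ?thesis using n(1) by (simp add: a_def field_simps)
    qed
    note bound = total_decomposition[where r = r and x = x and y = y and Y = Y
        and e = "\<lambda>t. a n t - x t" and \<eta> = "\<epsilon> / 2", OF dec har Y n(2) s]
    obtain m0 where m0: "real m0 > 4 * Y / \<epsilon>" using reals_Archimedean2 by blast
    have "norm (a m s - x s) < \<epsilon>" if m: "m \<ge> Suc m0" for m
    proof -
      have "\<bar>total r m s - real m * x s\<bar> \<le> 2 * Y + real m * (\<epsilon> / 2)"
        using bound[of m] Y[OF s] by linarith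
      also have "2 * Y < real m * (\<epsilon> / 2)"
      proof -
        have "4 * Y / \<epsilon> < real m" using m0 m by linarith
        then show ?thesis using \<epsilon> by (simp add: field_simps)
      qed
      finally have "\<bar>total r m s - real m * x s\<bar> < real m * \<epsilon>" by (simp add: mult.commute)
      moreover have "a m s - x s = (total r m s - real m * x s) / real m"
        using m by (simp add: a_def field_simps)
      ultimately show ?thesis using m by (simp add: pos_divide_less_eq mult.commute)
    qed
    then show "\<exists>no. \<forall>m\<ge>no. norm (a m s - x s) < \<epsilon>" by blast
  qed
  with har show ?thesis unfolding a_def by blast
qed

text \<open>The potential h turns a one-stage inequality into one for n stages, by monotonicity of
  \<open>step\<close>; the bound c on h pays for the terminal state.\<close>

lemma total_ge:
  assumes "\<And>s. s \<in> S \<Longrightarrow> h s + b \<le> r s + step h s" and "\<And>s. s \<in> S \<Longrightarrow> h s \<le> c"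
  shows "s \<in> S \<Longrightarrow> real n * b + h s - c \<le> total r n s"
proof (induction n arbitrary: s)
  case 0
  then show ?case using assms by simp
next
  case (Suc n)
  have "real n * b - c + step h s \<le> step (total r n) s"
  proof -
    have "step (\<lambda>t. (real n * b - c) + h t) s \<le> step (total r n) s"
      by (rule step_mono) (use Suc.IH in \<open>simp add: algebra_simps\<close>)
    then show ?thesis using Suc.prems by (simp only: step_add step_const)
  qed
  then show ?case using assms(1)[OF Suc.prems] by (simp add: algebra_simps)
qed

lemma total_uminus: "total (\<lambda>s. - r s) n s = - total r n s"
proof (induction n arbitrary: s)
  case (Suc n)
  then have "total (\<lambda>s. - r s) n = (\<lambda>s. (- 1) * total r n s)" by auto
  then show ?case by (simp only: total.simps step_mult)
qed simp

lemma average_limit_ge: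
  assumes "(\<lambda>n. total r n s / real n) \<longlonglongrightarrow> x" and "s \<in> S"
    and "\<And>s. s \<in> S \<Longrightarrow> h s + b \<le> r s + step h s"
  shows "b \<le> x"
proof -
  define c where "c = Max (h ` S)"
  have c: "h s \<le> c" if "s \<in> S" for s unfolding c_def using fin that by auto
  have "(\<lambda>n. b + (h s - c) / real n) \<longlonglongrightarrow> b + 0"
    by (intro tendsto_add tendsto_const
        real_tendsto_divide_at_top[OF tendsto_const filterlim_real_sequentially])
  moreover have "b + (h s - c) / real n \<le> total r n s / real n" if "n \<ge> 1" for n
  proof -
    have "b + (h s - c) / real n = (real n * b + h s - c) / real n"
      using that by (simp add: field_simps)
    also have "\<dots> \<le> total r n s / real n"
      by (intro divide_right_mono total_ge assms c) auto
    finally show ?thesis .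
  qed
  ultimately have "b + 0 \<le> x" using LIMSEQ_le[OF _ assms(1)] by blast
  then show ?thesis by simp
qed

lemma average_limit_le:
  assumes "(\<lambda>n. total r n s / real n) \<longlonglongrightarrow> x" and "s \<in> S"
    and "\<And>s. s \<in> S \<Longrightarrow> r s + step h s \<le> h s + b"
  shows "x \<le> b"
proof -
  have "(\<lambda>n. total (\<lambda>s. - r s) n s / real n) \<longlonglongrightarrow> - x"
    using tendsto_minus[OF assms(1)] by (simp add: total_uminus)
  then have "- b \<le> - x"
    using assms(2)
  proof (rule average_limit_ge)
    show "- h s + - b \<le> - r s + step (\<lambda>s. - h s) s" if "s \<in> S" for s
      using assms(3)[OF that] step_mult[of "- 1" h s] by simp
  qed
  then show ?thesis by simp
qed

section \<open>Hitting probabilities and recurrence\<close>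

lemma hit_bounds: "s \<in> S \<Longrightarrow> 0 \<le> hit z n s \<and> hit z n s \<le> 1"
proof (induction n arbitrary: s)
  case (Suc n)
  have "step (\<lambda>_. 0) s \<le> step (hit z n) s" "step (hit z n) s \<le> step (\<lambda>_. 1) s"
    by (intro step_mono; use Suc.IH in auto)+
  then show ?case using Suc.prems by (simp add: step_const)
qed simp

lemma hit_mono: "s \<in> S \<Longrightarrow> hit z n s \<le> hit z (Suc n) s"
proof (induction n arbitrary: s)
  case 0
  then show ?case using hit_bounds[of s z 1] by simp
next
  case (Suc n)
  have "step (hit z n) s \<le> step (hit z (Suc n)) s"
    by (rule step_mono) (rule Suc.IH)
  then show ?case by simp
qed

text \<open>In a minimal closed set every state is hit almost surely, by the minimum principle.\<close>

theorem recurrent_state_exists: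
  assumes "closed_set U" "U \<noteq> {}"
  shows "\<exists>z\<in>U. (\<lambda>n. step (hit z n) z) \<longlonglongrightarrow> 1"
proof -
  have finU: "finite U" using assms(1) fin finite_subset by (auto simp: closed_set_def)
  define F where "F V \<longleftrightarrow> V \<subseteq> U \<and> V \<noteq> {} \<and> closed_set V" for V
  have "F U" using assms by (simp add: F_def)
  then obtain V where FV: "F V" and least: "\<And>W. F W \<Longrightarrow> card V \<le> card W"
    using ex_has_least_nat[of F U card] by blast
  have V: "V \<subseteq> U" "V \<noteq> {}" "closed_set V" using FV by (auto simp: F_def)
  have minimal: "V = W" if "W \<subseteq> V" "W \<noteq> {}" "closed_set W" for W
  proof -
    have "F W" using that V(1) by (auto simp: F_def)
    then have "card V \<le> card W" by (rule least)
    then show ?thesis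
      using card_seteq[of V W] finite_subset[OF V(1) finU] that(1) by simp
  qed
  obtain z where z: "z \<in> V" using V(2) by auto
  have VS: "V \<subseteq> S" using V(3) by (auto simp: closed_set_def)
  have "convergent (\<lambda>n. hit z n s)" if "s \<in> S" for s
  proof (rule Bseq_mono_convergent)
    show "Bseq (\<lambda>n. hit z n s)"
      using hit_bounds[OF that] by (intro BseqI'[where K = 1]) (simp add: abs_le_iff order_trans[OF _ zero_le_one])
    show "\<forall>m n. m \<le> n \<longrightarrow> hit z m s \<le> hit z n s"
      using lift_Suc_mono_le[of "\<lambda>n. hit z n s", OF hit_mono[OF that]] by blast
  qed
  \<comment> \<open>f is the probability of ever hitting z; it is harmonic away from z.\<close>
  then obtain f where f: "\<And>s. s \<in> S \<Longrightarrow> (\<lambda>n. hit z n s) \<longlonglongrightarrow> f s"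
    unfolding convergent_def by metis
  have f_le: "f s \<le> 1" if "s \<in> S" for s
    by (rule LIMSEQ_le_const2[OF f[OF that]]) (use hit_bounds[OF that] in auto)
  have f_z: "f z = 1"
  proof -
    have "(\<lambda>n. hit z (Suc n) z) \<longlonglongrightarrow> f z" using LIMSEQ_Suc[OF f] z VS by blast
    then show ?thesis using LIMSEQ_unique[OF tendsto_const[of "1::real"]] by auto
  qed
  have f_step: "step f s = f s" if "s \<in> S" "s \<noteq> z" for s
  proof -
    have "(\<lambda>n. hit z (Suc n) s) \<longlonglongrightarrow> f s" by (rule LIMSEQ_Suc[OF f[OF that(1)]])
    moreover have "(\<lambda>n. hit z (Suc n) s) \<longlonglongrightarrow> step f s"
      using that step_tendsto[of "hit z" f, OF f] by simp
    ultimately show ?thesis by (rule LIMSEQ_unique[symmetric])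
  qed
  have fV: "f s = 1" if s: "s \<in> V" for s
  proof (rule ccontr)
    assume "f s \<noteq> 1"
    define m where "m = Min (f ` V)"
    have finV: "finite V" using VS fin finite_subset by blast
    have m: "m \<le> f t" if "t \<in> V" for t unfolding m_def using finV that by auto
    have "m < 1" using m[OF s] f_le[of s] s VS \<open>f s \<noteq> 1\<close> by fastforce
    \<comment> \<open>This set avoids z, so f is harmonic on it and the minimum principle makes it
      closed; minimality of V then forces it to be all of V, z included.\<close>
    let ?W = "{t \<in> V. f t = m}"
    have "m \<in> f ` V" unfolding m_def using finV z by (intro Min_in) auto
    then have "?W \<noteq> {}" by auto
    moreover have "closed_set ?W"
      unfolding closed_set_def
    proof (intro conjI ballI impI)
      fix u t assume u: "u \<in> ?W" and t: "t \<in> S" "0 < p u t"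
      have succ: "t' \<in> V" if "t' \<in> S" "0 < p u t'" for t'
        using V(3) u that by (auto simp: closed_set_def)
      have "u \<noteq> z" using u f_z \<open>m < 1\<close> by auto
      then have "step f u = f u" using u VS by (intro f_step) auto
      then have "f t = f u"
        using u VS m succ by (intro minimum_principle[of u f t] t) auto
      then show "t \<in> ?W" using succ t u by auto
    qed (use VS in auto)
    ultimately have "V = ?W" by (intro minimal) auto
    then have "f z = m" using z by blast
    then show False using f_z \<open>m < 1\<close> by simp
  qed
  have "step f z = step (\<lambda>_. 1) z"
    unfolding step_def
  proof (intro sum.cong refl)
    fix t assume "t \<in> S"
    then show "p z t * f t = p z t * 1"
      using fV[of t] V(3) z nonneg[of z t] by (cases "p z t = 0") (auto simp: closed_set_def)
  qed
  then have "step f z = 1" using z VS by (auto simp: step_const)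
  then show ?thesis using step_tendsto[of "hit z" f z, OF f] z V(1) by auto
qed

end


section \<open>The span seminorm\<close>

lemma diff_le_sp_norm: "finite I \<Longrightarrow> i \<in> I \<Longrightarrow> j \<in> I \<Longrightarrow> x i - x j \<le> sp_norm I x"
  unfolding sp_norm_def by (intro diff_mono Max_ge Min_le) auto

lemma sp_norm_leI:
  assumes "finite I" "I \<noteq> {}" "\<And>i j. i \<in> I \<Longrightarrow> j \<in> I \<Longrightarrow> x i - x j \<le> c"
  shows "sp_norm I x \<le> c"
proof -
  have "Max (x ` I) \<in> x ` I" "Min (x ` I) \<in> x ` I"
    using assms by (auto intro!: Max_in Min_in)
  then show ?thesis using assms(3) unfolding sp_norm_def by auto
qed

locale mdp_context =
  fixes M :: "('s, 'a) mdp"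
  assumes finite_mdp: "finite_mdp M"
begin

lemma finite_states: "finite (states M)" and states_nonempty: "states M \<noteq> {}"
  and finite_actions: "finite (actions M)" and actions_nonempty: "actions M \<noteq> {}"
  and set_kernel: "s \<in> states M \<Longrightarrow> a \<in> actions M \<Longrightarrow> set_pmf (kernel M s a) \<subseteq> states M"
  using finite_mdp by (auto simp: finite_mdp_def)

lemma sum_kernel: "s \<in> states M \<Longrightarrow> a \<in> actions M \<Longrightarrow> (\<Sum>t\<in>states M. pmf (kernel M s a) t) = 1"
  by (rule sum_pmf_eq_1[OF finite_states set_kernel])

lemma sp_state_ge: "s \<in> states M \<Longrightarrow> t \<in> states M \<Longrightarrow> h s - h t \<le> sp_state M h"
  unfolding sp_state_def by (rule diff_le_sp_norm[OF finite_states])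

lemma sp_state_leI:
  "(\<And>s t. s \<in> states M \<Longrightarrow> t \<in> states M \<Longrightarrow> h s - h t \<le> c) \<Longrightarrow> sp_state M h \<le> c"
  unfolding sp_state_def by (rule sp_norm_leI[OF finite_states states_nonempty])

lemma sp_mat_ge:
  assumes "s \<in> states M" "a \<in> actions M" "t \<in> states M" "b \<in> actions M"
  shows "Q s a - Q t b \<le> sp_mat M Q"
  using diff_le_sp_norm[of "states M \<times> actions M" "(s, a)" "(t, b)" "\<lambda>(s, a). Q s a"]
    finite_states finite_actions assms unfolding sp_mat_def by auto

lemma sp_mat_leI:
  assumes "\<And>s a t b. s \<in> states M \<Longrightarrow> a \<in> actions M \<Longrightarrow> t \<in> states M \<Longrightarrow> b \<in> actions M \<Longrightarrow>
    Q s a - Q t b \<le> c"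
  shows "sp_mat M Q \<le> c"
  unfolding sp_mat_def
  by (rule sp_norm_leI)
     (use assms finite_states finite_actions states_nonempty actions_nonempty in auto)

lemma sp_state_nonneg: "0 \<le> sp_state M h"
  using sp_state_ge[of _ _ h] states_nonempty by fastforce

lemma sp_mat_cong:
  assumes "\<And>s a. s \<in> states M \<Longrightarrow> a \<in> actions M \<Longrightarrow> Q s a = Q' s a"
  shows "sp_mat M Q = sp_mat M Q'"
  unfolding sp_mat_def sp_norm_def
  by (intro arg_cong2[where f = minus] arg_cong[where f = Max] arg_cong[where f = Min] image_cong)
     (use assms in auto)

lemma sp_mat_add_le: "sp_mat M (\<lambda>s a. Q s a + Q' s a) \<le> sp_mat M Q + sp_mat M Q'"
  using sp_mat_ge[of _ _ _ _ Q] sp_mat_ge[of _ _ _ _ Q'] by (intro sp_mat_leI) fastforce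

lemma sp_mat_mult:
  assumes "0 \<le> c" shows "sp_mat M (\<lambda>s a. c * Q s a) \<le> c * sp_mat M Q"
  using mult_left_mono[OF sp_mat_ge assms, of _ _ _ _ Q]
  by (intro sp_mat_leI) (simp add: right_diff_distrib)

lemma sp_mat_uminus: "sp_mat M (\<lambda>s a. - Q s a) \<le> sp_mat M Q"
  using sp_mat_ge[of _ _ _ _ Q] by (intro sp_mat_leI) simp

lemma sp_mat_diff_le: "sp_mat M (\<lambda>s a. Q s a - Q' s a) \<le> sp_mat M Q + sp_mat M Q'"
  using sp_mat_add_le[of Q "\<lambda>s a. - Q' s a"] sp_mat_uminus[of Q'] by simp

lemma sp_mat_abs_le:
  assumes "\<And>s a. s \<in> states M \<Longrightarrow> a \<in> actions M \<Longrightarrow> \<bar>Q s a\<bar> \<le> c"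
  shows "sp_mat M Q \<le> 2 * c"
  using assms by (intro sp_mat_leI) (smt (verit))

lemma max_act_ge: "a \<in> actions M \<Longrightarrow> Q s a \<le> max_act M Q s"
  unfolding max_act_def using finite_actions by auto

lemma max_act_attained: obtains a where "a \<in> actions M" "max_act M Q s = Q s a"
proof -
  have "max_act M Q s \<in> Q s ` actions M"
    unfolding max_act_def using finite_actions actions_nonempty by (intro Max_in) auto
  then show ?thesis using that by auto
qed

text \<open>Compare through an action optimal for Q at s and one optimal for Q' at t: the other two
  maxima enter with a negative sign and are bounded below by the values at these actions.\<close>

lemma sp_state_max_act_diff:
  "sp_state M (\<lambda>s. max_act M Q s - max_act M Q' s) \<le> sp_mat M (\<lambda>s a. Q s a - Q' s a)"
proof (rule sp_state_leI)
  fix s t assume st: "s \<in> states M" "t \<in> states M"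
  obtain a where a: "a \<in> actions M" "max_act M Q s = Q s a" by (rule max_act_attained)
  obtain b where b: "b \<in> actions M" "max_act M Q' t = Q' t b" by (rule max_act_attained)
  show "max_act M Q s - max_act M Q' s - (max_act M Q t - max_act M Q' t)
      \<le> sp_mat M (\<lambda>s a. Q s a - Q' s a)"
    using sp_mat_ge[of s a t b "\<lambda>s a. Q s a - Q' s a"] st a b
      max_act_ge[of a Q' s] max_act_ge[of b Q t] by linarith
qed

lemma kernel_diff_le:
  assumes "s \<in> states M" "a \<in> actions M" "t \<in> states M" "b \<in> actions M"
  shows "(\<Sum>u\<in>states M. pmf (kernel M s a) u * h u) - (\<Sum>u\<in>states M. pmf (kernel M t b) u * h u)
    \<le> sp_state M h"
proof -
  let ?l = "Min (h ` states M)" and ?u = "Max (h ` states M)"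
  have "(\<Sum>u\<in>states M. pmf (kernel M s a) u * h u) \<le> (\<Sum>u\<in>states M. pmf (kernel M s a) u * ?u)"
    using finite_states by (intro sum_mono mult_left_mono Max_ge) auto
  moreover have "(\<Sum>u\<in>states M. pmf (kernel M t b) u * ?l) \<le> (\<Sum>u\<in>states M. pmf (kernel M t b) u * h u)"
    using finite_states by (intro sum_mono mult_left_mono Min_le) auto
  ultimately show ?thesis
    using sum_kernel[OF assms(1,2)] sum_kernel[OF assms(3,4)]
    by (simp add: sum_distrib_right[symmetric] sp_state_def sp_norm_def)
qed

lemma sp_bellman_diff:
  "sp_mat M (\<lambda>s a. bellman M Q s a - bellman M Q' s a) \<le> sp_mat M (\<lambda>s a. Q s a - Q' s a)"
proof -
  have "sp_mat M (\<lambda>s a. bellman M Q s a - bellman M Q' s a)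
      \<le> sp_state M (\<lambda>s. max_act M Q s - max_act M Q' s)"
    using kernel_diff_le[of _ _ _ _ "\<lambda>s. max_act M Q s - max_act M Q' s"]
    by (intro sp_mat_leI) (simp add: bellman_def right_diff_distrib sum_subtractf)
  then show ?thesis using sp_state_max_act_diff order_trans by blast
qed


section \<open>Gains\<close>

lemma finite_chain_policy:
  assumes "\<pi> \<in> policies M"
  shows "finite_chain (states M) (\<lambda>s t. pmf (kernel M s (\<pi> s)) t)"
  using assms finite_states states_nonempty sum_kernel
  by unfold_locales (auto simp: policies_def PiE_iff)

lemma policy_action: "\<pi> \<in> policies M \<Longrightarrow> s \<in> states M \<Longrightarrow> \<pi> s \<in> actions M"
  by (auto simp: policies_def)

lemma set_kernel_policy:
  "\<pi> \<in> policies M \<Longrightarrow> s \<in> states M \<Longrightarrow> set_pmf (kernel M s (\<pi> s)) \<subseteq> states M"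
  using set_kernel policy_action by blast

lemma finite_set_traj: "\<pi> \<in> policies M \<Longrightarrow> s \<in> states M \<Longrightarrow> finite (set_pmf (traj M \<pi> n s))"
proof (induction n arbitrary: s)
  case (Suc n)
  have "finite (set_pmf (kernel M s (\<pi> s)))"
    using set_kernel_policy[OF Suc.prems] finite_states finite_subset by blast
  then show ?case using Suc.IH set_kernel_policy[OF Suc.prems] Suc.prems(1) by auto
qed simp

lemma traj_Suc_expectation:
  fixes f :: "'s list \<Rightarrow> real"
  assumes "\<pi> \<in> policies M" "s \<in> states M"
  shows "measure_pmf.expectation (traj M \<pi> (Suc n) s) f
    = (\<Sum>t\<in>states M. pmf (kernel M s (\<pi> s)) t * measure_pmf.expectation (traj M \<pi> n t) (\<lambda>xs. f (s # xs)))"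
proof -
  have "measure_pmf.expectation (traj M \<pi> (Suc n) s) f
    = (\<Sum>t\<in>states M. pmf (kernel M s (\<pi> s)) t *\<^sub>R measure_pmf.expectation (map_pmf ((#) s) (traj M \<pi> n t)) f)"
    unfolding traj.simps
    using finite_set_traj[OF assms(1)] set_kernel_policy[OF assms]
    by (intro pmf_expectation_bind finite_states) auto
  then show ?thesis by simp
qed

lemma traj_expectation_total:
  assumes \<pi>: "\<pi> \<in> policies M"
  shows "s \<in> states M \<Longrightarrow>
    measure_pmf.expectation (traj M \<pi> n s) (\<lambda>xs. \<Sum>t<n. reward M (xs ! t) (\<pi> (xs ! t)))
    = finite_chain.total (states M) (\<lambda>s t. pmf (kernel M s (\<pi> s)) t) (\<lambda>s. reward M s (\<pi> s)) n s"
proof (induction n arbitrary: s)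
  case 0
  interpret finite_chain "states M" "\<lambda>s t. pmf (kernel M s (\<pi> s)) t"
    by (rule finite_chain_policy[OF \<pi>])
  show ?case by simp
next
  case (Suc n)
  interpret finite_chain "states M" "\<lambda>s t. pmf (kernel M s (\<pi> s)) t"
    by (rule finite_chain_policy[OF \<pi>])
  have "measure_pmf.expectation (traj M \<pi> (Suc n) s) (\<lambda>xs. \<Sum>t<Suc n. reward M (xs ! t) (\<pi> (xs ! t)))
    = (\<Sum>t\<in>states M. pmf (kernel M s (\<pi> s)) t * (reward M s (\<pi> s)
        + measure_pmf.expectation (traj M \<pi> n t) (\<lambda>xs. \<Sum>t<n. reward M (xs ! t) (\<pi> (xs ! t)))))"
    unfolding traj_Suc_expectation[OF \<pi> Suc.prems]
    by (intro sum.cong refl arg_cong[where f = "(*) _"])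
       (simp add: sum.lessThan_Suc_shift integrable_measure_pmf_finite finite_set_traj[OF \<pi>]
         del: sum.lessThan_Suc)
  also have "\<dots> = step (\<lambda>t. reward M s (\<pi> s)
      + total (\<lambda>s. reward M s (\<pi> s)) n t) s"
    unfolding step_def by (intro sum.cong refl) (simp add: Suc.IH)
  also have "\<dots> = total (\<lambda>s. reward M s (\<pi> s)) (Suc n) s"
    using Suc.prems by (simp add: step_add step_const)
  finally show ?case .
qed

text \<open>\<open>gain\<close> is defined by the operator \<open>lim\<close>, which carries
  information only once convergence is known; the mean ergodic theorem supplies it, together with
  harmonicity.\<close>

lemma gain_limit:
  assumes "\<pi> \<in> policies M"
  shows "s \<in> states M \<Longrightarrow>
      (\<lambda>n. finite_chain.total (states M) (\<lambda>s t. pmf (kernel M s (\<pi> s)) t) (\<lambda>s. reward M s (\<pi> s)) n s / real n)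
        \<longlonglongrightarrow> gain M \<pi> s"
    and "s \<in> states M \<Longrightarrow>
      finite_chain.step (states M) (\<lambda>s t. pmf (kernel M s (\<pi> s)) t) (gain M \<pi>) s = gain M \<pi> s"
proof -
  interpret finite_chain "states M" "\<lambda>s t. pmf (kernel M s (\<pi> s)) t"
    by (rule finite_chain_policy[OF assms])
  let ?r = "\<lambda>s. reward M s (\<pi> s)"
  obtain x where x: "\<And>s. s \<in> states M \<Longrightarrow> (\<lambda>n. total ?r n s / real n) \<longlonglongrightarrow> x s"
    and har: "\<And>s. s \<in> states M \<Longrightarrow> step x s = x s"
    using average_converges[of ?r] by blast
  have gain: "gain M \<pi> s = x s" if "s \<in> states M" for s
  proof -
    have "measure_pmf.expectation (traj M \<pi> n s)
        (\<lambda>xs. (1 / real n) * (\<Sum>t<n. reward M (xs ! t) (\<pi> (xs ! t)))) = total ?r n s / real n" for n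
      by (simp only: integral_mult_right_zero traj_expectation_total[OF assms that]) simp
    then show ?thesis unfolding gain_def by (simp only: limI[OF x[OF that]])
  qed
  show "(\<lambda>n. total ?r n s / real n) \<longlonglongrightarrow> gain M \<pi> s" if "s \<in> states M"
    using x[OF that] gain[OF that] by simp
  show "step (gain M \<pi>) s = gain M \<pi> s" if "s \<in> states M"
    using har[OF that] gain step_cong[of "gain M \<pi>" x s] that by simp
qed

lemma finite_policies: "finite (policies M)" and policies_nonempty: "policies M \<noteq> {}"
  using finite_states finite_actions actions_nonempty
  by (auto simp: policies_def intro!: finite_PiE simp: PiE_eq_empty_iff)

lemma gain_le_opt_gain: "\<pi> \<in> policies M \<Longrightarrow> gain M \<pi> s \<le> opt_gain M s"
  unfolding opt_gain_def using finite_policies by auto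

lemma opt_gain_attained: obtains \<pi> where "\<pi> \<in> policies M" "opt_gain M s = gain M \<pi> s"
proof -
  have "opt_gain M s \<in> (\<lambda>\<pi>. gain M \<pi> s) ` policies M"
    unfolding opt_gain_def using finite_policies policies_nonempty by (intro Max_in) auto
  then show ?thesis using that by auto
qed

text \<open>
  With \<open>b \<le> \<T>(Q) - Q \<le> B\<close>, the greedy policy gains at least \<open>b\<close> and no policy more than \<open>B\<close>.
\<close>

lemma greedy_gain_gap:
  assumes \<pi>: "\<pi> \<in> greedy_policies M Q" and s: "s \<in> states M"
  shows "opt_gain M s - gain M \<pi> s \<le> sp_mat M (\<lambda>s a. Q s a - bellman M Q s a)"
proof -
  let ?D = "\<lambda>(s, a). bellman M Q s a - Q s a" and ?I = "states M \<times> actions M"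
  have fin: "finite ?I" using finite_states finite_actions by simp
  define b where "b = Min (?D ` ?I)"
  define B where "B = Max (?D ` ?I)"
  have bB: "b \<le> bellman M Q s a - Q s a" "bellman M Q s a - Q s a \<le> B"
    if "s \<in> states M" "a \<in> actions M" for s a
    using that fin by (auto simp: b_def B_def intro!: Min.coboundedI Max.coboundedI intro: rev_image_eqI)
  have "B - b \<le> sp_mat M (\<lambda>s a. Q s a - bellman M Q s a)"
  proof -
    have "?I \<noteq> {}" using states_nonempty actions_nonempty by simp
    then have "B \<in> ?D ` ?I" "b \<in> ?D ` ?I"
      unfolding b_def B_def using fin by (auto intro!: Max_in Min_in)
    then obtain s a t c where "s \<in> states M" "a \<in> actions M" "t \<in> states M" "c \<in> actions M"
      and "B = bellman M Q s a - Q s a" "b = bellman M Q t c - Q t c" by auto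
    then show ?thesis using sp_mat_ge[of t c s a "\<lambda>s a. Q s a - bellman M Q s a"] by simp
  qed
  moreover have "b \<le> gain M \<pi> s"
  proof -
    have \<pi>': "\<pi> \<in> policies M" using \<pi> by (simp add: greedy_policies_def)
    interpret finite_chain "states M" "\<lambda>s t. pmf (kernel M s (\<pi> s)) t"
      by (rule finite_chain_policy[OF \<pi>'])
    show ?thesis
    \<comment> \<open>The potential is \<open>max_act M Q\<close>; greediness makes it equal to
      \<open>Q t (\<pi> t)\<close>, where the lower bound b applies.\<close>
    proof (rule average_limit_ge[OF gain_limit(1)[OF \<pi>' s] s])
      fix t assume t: "t \<in> states M"
      obtain a where "a \<in> actions M" "max_act M Q t = Q t a" by (rule max_act_attained)
      then have "max_act M Q t \<le> Q t (\<pi> t)" using \<pi> t by (auto simp: greedy_policies_def)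
      then show "max_act M Q t + b \<le> reward M t (\<pi> t) + step (max_act M Q) t"
        using bB(1)[OF t policy_action[OF \<pi>' t]] by (simp add: bellman_def step_def)
    qed
  qed
  moreover have "opt_gain M s \<le> B"
  proof -
    obtain \<sigma> where \<sigma>: "\<sigma> \<in> policies M" "opt_gain M s = gain M \<sigma> s" by (rule opt_gain_attained)
    interpret finite_chain "states M" "\<lambda>s t. pmf (kernel M s (\<sigma> s)) t"
      by (rule finite_chain_policy[OF \<sigma>(1)])
    show ?thesis unfolding \<sigma>(2)
    proof (rule average_limit_le[OF gain_limit(1)[OF \<sigma>(1) s] s])
      fix t assume t: "t \<in> states M"
      show "reward M t (\<sigma> t) + step (max_act M Q) t \<le> max_act M Q t + B"
        using bB(2)[OF t policy_action[OF \<sigma>(1) t]] max_act_ge[OF policy_action[OF \<sigma>(1) t], of Q t]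
        by (simp add: bellman_def step_def)
    qed
  qed
  ultimately show ?thesis by linarith
qed


section \<open>Reachability and constancy of the optimal gain\<close>

text \<open>Its closure is reachability with a free choice of action at every visit. Unlike
  accessibility, whose witness is one fixed policy per pair of states, it composes
  immediately.\<close>

definition succ :: "('s \<times> 's) set" where
  "succ = {(s, t). s \<in> states M \<and> (\<exists>a\<in>actions M. 0 < pmf (kernel M s a) t)}"

lemma succ_policy:
  "\<pi> \<in> policies M \<Longrightarrow> s \<in> states M \<Longrightarrow> 0 < pmf (kernel M s (\<pi> s)) t \<Longrightarrow> (s, t) \<in> succ"
  using policy_action by (auto simp: succ_def)

lemma succ_in_states: "(s, t) \<in> succ \<Longrightarrow> t \<in> states M"
  using set_kernel by (auto simp: succ_def pmf_positive_iff)

lemma succ_rtrancl_in_states: "(s, t) \<in> succ\<^sup>* \<Longrightarrow> s \<in> states M \<Longrightarrow> t \<in> states M"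
  by (induction rule: rtrancl_induct) (auto intro: succ_in_states)

lemma traj_nth_reachable:
  assumes "\<pi> \<in> policies M"
  shows "s \<in> states M \<Longrightarrow> xs \<in> set_pmf (traj M \<pi> (Suc n) s) \<Longrightarrow> t \<le> n \<Longrightarrow> (s, xs ! t) \<in> succ\<^sup>*"
proof (induction n arbitrary: s xs t)
  case 0
  then show ?case by (auto simp: )
next
  case (Suc n)
  obtain s' ys where s': "s' \<in> set_pmf (kernel M s (\<pi> s))"
    and ys: "ys \<in> set_pmf (traj M \<pi> (Suc n) s')" and xs: "xs = s # ys"
    using Suc.prems(2) unfolding traj.simps(2)[of M \<pi> "Suc n" s] set_bind_pmf set_map_pmf by blast
  have succ: "(s, s') \<in> succ"
    using succ_policy[OF assms Suc.prems(1)] s' by (simp add: pmf_positive_iff)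
  show ?case
  proof (cases t)
    case 0
    then show ?thesis using xs by simp
  next
    case (Suc t')
    then have "(s', ys ! t') \<in> succ\<^sup>*"
      using Suc.IH[OF succ_in_states[OF succ] ys] Suc.prems by simp
    then show ?thesis using succ Suc xs by (simp add: converse_rtrancl_into_rtrancl)
  qed
qed

lemma accessible_reachable:
  assumes "\<pi> \<in> policies M" "s \<in> states M" "accessible M \<pi> s t"
  shows "(s, t) \<in> succ\<^sup>*"
proof -
  obtain n where "measure_pmf.prob (traj M \<pi> (Suc n) s) {xs. xs ! n = t} > 0"
    using assms(3) by (auto simp: accessible_def)
  then have "set_pmf (traj M \<pi> (Suc n) s) \<inter> {xs. xs ! n = t} \<noteq> {}"
    using measure_pmf_zero_iff by (metis less_irrefl)
  then show ?thesis using traj_nth_reachable[OF assms(1,2), of _ n n] by blast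
qed

lemma prob_traj_Suc:
  assumes "\<pi> \<in> policies M" "s \<in> states M"
  shows "measure_pmf.prob (traj M \<pi> (Suc n) s) X
    = (\<Sum>t\<in>states M. pmf (kernel M s (\<pi> s)) t * measure_pmf.prob (traj M \<pi> n t) {xs. s # xs \<in> X})"
proof -
  have "(\<lambda>xs. indicator X (s # xs)) = (indicator {xs. s # xs \<in> X} :: 's list \<Rightarrow> real)"
    by (auto simp: indicator_def)
  then show ?thesis
    using traj_Suc_expectation[OF assms, of n "indicator X"] by (simp del: traj.simps)
qed

lemma prob_hit:
  assumes \<pi>: "\<pi> \<in> policies M"
  shows "s \<in> states M \<Longrightarrow> measure_pmf.prob (traj M \<pi> n s) {xs. z \<in> set xs}
    = finite_chain.hit (states M) (\<lambda>s t. pmf (kernel M s (\<pi> s)) t) z n s"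
proof (induction n arbitrary: s)
  case 0
  interpret finite_chain "states M" "\<lambda>s t. pmf (kernel M s (\<pi> s)) t"
    by (rule finite_chain_policy[OF \<pi>])
  show ?case by simp
next
  case (Suc n)
  interpret finite_chain "states M" "\<lambda>s t. pmf (kernel M s (\<pi> s)) t"
    by (rule finite_chain_policy[OF \<pi>])
  show ?case
  proof (cases "s = z")
    case True
    then show ?thesis
      unfolding prob_traj_Suc[OF \<pi> Suc.prems] using sum_kernel policy_action[OF \<pi>] Suc.prems by simp
  next
    case False
    then have "{xs. s # xs \<in> {xs. z \<in> set xs}} = {xs. z \<in> set xs}" by auto
    then show ?thesis
      unfolding prob_traj_Suc[OF \<pi> Suc.prems] using False Suc.IH by (simp add: step_def)
  qed
qed

text \<open>Dropping the head of a trajectory from z leaves a trajectory from its successor, so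
  \<open>step (hit z n) z\<close> is one of the probabilities whose supremum is
  \<open>return_prob\<close>.\<close>

lemma recurrent_not_transient:
  assumes \<pi>: "\<pi> \<in> policies M" and z: "z \<in> states M"
    and lim: "(\<lambda>n. finite_chain.step (states M) (\<lambda>s t. pmf (kernel M s (\<pi> s)) t)
       (finite_chain.hit (states M) (\<lambda>s t. pmf (kernel M s (\<pi> s)) t) z n) z) \<longlonglongrightarrow> 1"
  shows "\<not> transient M \<pi> z"
proof -
  interpret finite_chain "states M" "\<lambda>s t. pmf (kernel M s (\<pi> s)) t"
    by (rule finite_chain_policy[OF \<pi>])
  have eq: "step (hit z n) z = measure_pmf.prob (traj M \<pi> (Suc n) z) {xs. z \<in> set (tl xs)}" for n
    unfolding prob_traj_Suc[OF \<pi> z] using prob_hit[OF \<pi>] by (simp add: step_def)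
  have "step (hit z n) z \<le> return_prob M \<pi> z" for n
    unfolding eq return_prob_def by (rule cSUP_upper) (auto intro!: bdd_aboveI[where M = 1])
  then have "1 \<le> return_prob M \<pi> z" using LIMSEQ_le_const2[OF lim] by blast
  then show ?thesis by (simp add: transient_def)
qed

text \<open>Every nonempty closed set contains a recurrent state, which must lie in C because states
  outside are transient. Applied to U and to the set reachable from s, this yields two states of C,
  and C is mutually accessible.\<close>

lemma weakly_communicating_reachable:
  assumes wc: "weakly_communicating M" and \<pi>: "\<pi> \<in> policies M"
    and U: "finite_chain.closed_set (states M) (\<lambda>s t. pmf (kernel M s (\<pi> s)) t) U" "U \<noteq> {}"
    and s: "s \<in> states M"
  shows "\<exists>u\<in>U. (s, u) \<in> succ\<^sup>*"
proof -
  obtain C where C: "C \<subseteq> states M"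
    and acc: "\<And>s t. s \<in> C \<Longrightarrow> t \<in> C \<Longrightarrow> s \<noteq> t \<Longrightarrow> \<exists>\<pi>\<in>policies M. accessible M \<pi> s t"
    and trans: "\<And>s \<pi>. s \<in> states M - C \<Longrightarrow> \<pi> \<in> policies M \<Longrightarrow> transient M \<pi> s"
    using wc unfolding weakly_communicating_def by auto
  interpret finite_chain "states M" "\<lambda>s t. pmf (kernel M s (\<pi> s)) t"
    by (rule finite_chain_policy[OF \<pi>])
  have in_C: "\<exists>z\<in>V. z \<in> C" if V: "closed_set V" "V \<noteq> {}" for V
  proof -
    obtain z where z: "z \<in> V" "(\<lambda>n. step (hit z n) z) \<longlonglongrightarrow> 1"
      using recurrent_state_exists[OF V] by blast
    have zS: "z \<in> states M" using V z by (auto simp: closed_set_def)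
    from recurrent_not_transient[OF \<pi> zS z(2)] trans[OF _ \<pi>] zS z(1) show ?thesis by blast
  qed
  have "closed_set {t. (s, t) \<in> succ\<^sup>*}"
    unfolding closed_set_def
    using succ_rtrancl_in_states[OF _ s] succ_policy[OF \<pi>] by (auto intro: rtrancl_into_rtrancl)
  then obtain c where c: "(s, c) \<in> succ\<^sup>*" "c \<in> C" using in_C[of "{t. (s, t) \<in> succ\<^sup>*}"] by blast
  obtain u where u: "u \<in> U" "u \<in> C" using in_C[OF U] by blast
  have "(c, u) \<in> succ\<^sup>*"
    using acc[OF c(2) u(2)] accessible_reachable C c(2) by (cases "c = u") auto
  then show ?thesis using c(1) u(1) by (meson rtrancl_trans)
qed

text \<open>
  Let \<open>\<pi>\<close> be optimal at a state of maximal optimal gain \<open>m\<close>.  Its gain is harmonic, so \<open>m\<close> is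
  attained on a closed set \<open>R\<close>; following \<open>\<pi>\<close> on \<open>R\<close> and shortest paths to \<open>R\<close> outside gives
  gain \<open>m\<close> everywhere.
\<close>

theorem opt_gain_constant:
  assumes wc: "weakly_communicating M"
  shows "\<exists>g. \<forall>s\<in>states M. opt_gain M s = g"
proof -
  define m where "m = Max (opt_gain M ` states M)"
  have le_m: "opt_gain M s \<le> m" if "s \<in> states M" for s
    unfolding m_def using that finite_states by auto
  have "m \<in> opt_gain M ` states M"
    unfolding m_def using finite_states states_nonempty by (intro Max_in) auto
  then obtain s0 where s0: "s0 \<in> states M" "opt_gain M s0 = m" by auto
  obtain \<pi> where \<pi>: "\<pi> \<in> policies M" "gain M \<pi> s0 = m"
    using opt_gain_attained[of s0] s0(2) by metis
  interpret P: finite_chain "states M" "\<lambda>s t. pmf (kernel M s (\<pi> s)) t"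
    by (rule finite_chain_policy[OF \<pi>(1)])
  define R where "R = {s \<in> states M. gain M \<pi> s = m}"
  have gain_le: "gain M \<pi> s \<le> m" if "s \<in> states M" for s
    using gain_le_opt_gain[OF \<pi>(1)] le_m[OF that] order_trans by blast
  have R_closed: "P.closed_set R"
    unfolding P.closed_set_def
  proof (intro conjI ballI impI)
    fix s t assume st: "s \<in> R" "t \<in> states M" "0 < pmf (kernel M s (\<pi> s)) t"
    have s: "s \<in> states M" using st by (simp add: R_def)
    \<comment> \<open>The principle is applied to the negated gain, which is minimal on R.\<close>
    have "- gain M \<pi> t = - gain M \<pi> s"
    proof (rule P.minimum_principle[OF s, where f = "\<lambda>s. - gain M \<pi> s"])
      show "P.step (\<lambda>s. - gain M \<pi> s) s = - gain M \<pi> s"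
        using P.step_mult[of "- 1" "gain M \<pi>" s] gain_limit(2)[OF \<pi>(1) s] by simp
      show "- gain M \<pi> s \<le> - gain M \<pi> t'" if "t' \<in> states M" for t'
        using st(1) gain_le[OF that] by (simp add: R_def)
    qed (use st in auto)
    then show "t \<in> R" using st by (simp add: R_def)
  qed (auto simp: R_def)
  have "R \<noteq> {}" using s0 \<pi> by (auto simp: R_def)
  then have reach: "\<exists>n. \<exists>u\<in>R. (s, u) \<in> succ ^^ n" if "s \<in> states M" for s
    using weakly_communicating_reachable[OF wc \<pi>(1) R_closed _ that] by (auto dest!: rtrancl_imp_relpow)
  define dist where "dist s = (LEAST n. \<exists>u\<in>R. (s, u) \<in> succ ^^ n)" for s
  have dist: "\<exists>u\<in>R. (s, u) \<in> succ ^^ dist s" if "s \<in> states M" for s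
    unfolding dist_def by (rule LeastI_ex[OF reach[OF that]])
  have "\<exists>a\<in>actions M. \<exists>t. 0 < pmf (kernel M s a) t \<and> dist t < dist s" if s: "s \<in> states M - R" for s
  proof -
    obtain u where u: "u \<in> R" "(s, u) \<in> succ ^^ dist s" using dist s by blast
    with s obtain n where n: "dist s = Suc n" by (cases "dist s") auto
    then obtain t where t: "(s, t) \<in> succ" "(t, u) \<in> succ ^^ n"
      using u(2) relpow_Suc_D2 by metis
    have "dist t \<le> n" unfolding dist_def using u(1) t(2) by (intro Least_le) auto
    then have "dist t < dist s" using n by simp
    then show ?thesis using t(1) by (auto simp: succ_def)
  qed
  then obtain a where a: "\<And>s. s \<in> states M - R \<Longrightarrow> a s \<in> actions M"
    and a_dist: "\<And>s. s \<in> states M - R \<Longrightarrow> \<exists>t. 0 < pmf (kernel M s (a s)) t \<and> dist t < dist s"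
    by metis
  define \<sigma> where "\<sigma> s = (if s \<in> states M - R then a s else \<pi> s)" for s
  have \<sigma>: "\<sigma> \<in> policies M"
    using \<pi>(1) a by (auto simp: policies_def \<sigma>_def PiE_iff extensional_def)
  interpret Q: finite_chain "states M" "\<lambda>s t. pmf (kernel M s (\<sigma> s)) t"
    by (rule finite_chain_policy[OF \<sigma>])
  \<comment> \<open>\<sigma> follows \<pi> on R and \<pi> never leaves R, so both chains accumulate
    the same reward from there.\<close>
  have "Q.total (\<lambda>s. reward M s (\<sigma> s)) n s = P.total (\<lambda>s. reward M s (\<pi> s)) n s" if "s \<in> R" for n s
    using that
  proof (induction n arbitrary: s)
    case (Suc n)
    have "\<sigma> s = \<pi> s" using Suc.prems by (simp add: \<sigma>_def)
    moreover have "Q.step (Q.total (\<lambda>s. reward M s (\<sigma> s)) n) s = P.step (P.total (\<lambda>s. reward M s (\<pi> s)) n) s"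
      unfolding P.step_def Q.step_def \<open>\<sigma> s = \<pi> s\<close>
    proof (intro sum.cong refl)
      fix t assume "t \<in> states M"
      then show "pmf (kernel M s (\<pi> s)) t * Q.total (\<lambda>s. reward M s (\<sigma> s)) n t
          = pmf (kernel M s (\<pi> s)) t * P.total (\<lambda>s. reward M s (\<pi> s)) n t"
        using R_closed Suc.IH[of t] Suc.prems pmf_nonneg[of "kernel M s (\<pi> s)" t]
        by (cases "pmf (kernel M s (\<pi> s)) t = 0") (auto simp: P.closed_set_def)
    qed
    ultimately show ?case by simp
  qed simp
  then have gain_R: "gain M \<sigma> s = m" if "s \<in> R" for s
    using gain_limit(1)[OF \<sigma>, of s] gain_limit(1)[OF \<pi>(1), of s] that LIMSEQ_unique
    by (fastforce simp: R_def)
  have "m \<le> gain M \<sigma> s" if s: "s \<in> states M" for s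
  proof (rule ccontr)
    assume neg: "\<not> m \<le> gain M \<sigma> s"
    define l where "l = Min (gain M \<sigma> ` states M)"
    have l: "l \<le> gain M \<sigma> t" if "t \<in> states M" for t unfolding l_def using that finite_states by auto
    have "l < m" using l[OF s] neg by simp
    have "l \<in> gain M \<sigma> ` states M"
      unfolding l_def using finite_states states_nonempty by (intro Min_in) auto
    \<comment> \<open>Among the states of minimal gain, w is closest to R. Some successor of w is
      closer still and has the same gain by the minimum principle; this replaces an argument that R
      is reached almost surely.\<close>
    then obtain w where w: "w \<in> states M \<and> gain M \<sigma> w = l"
      and least: "\<And>v. v \<in> states M \<and> gain M \<sigma> v = l \<Longrightarrow> dist w \<le> dist v"
      using ex_has_least_nat[of "\<lambda>w. w \<in> states M \<and> gain M \<sigma> w = l" _ dist] by blast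
    have wR: "w \<in> states M - R" using w gain_R \<open>l < m\<close> by auto
    then obtain t where t: "0 < pmf (kernel M w (a w)) t" "dist t < dist w" using a_dist by blast
    then have pos: "0 < pmf (kernel M w (\<sigma> w)) t" using wR by (simp add: \<sigma>_def)
    then have tS: "t \<in> states M" using succ_in_states succ_policy[OF \<sigma>] w by blast
    have "gain M \<sigma> t = gain M \<sigma> w"
      using w l by (intro Q.minimum_principle[of w "gain M \<sigma>" t] gain_limit(2)[OF \<sigma>] pos tS) auto
    then show False using least[of t] tS w t(2) by simp
  qed
  then have "opt_gain M s = m" if "s \<in> states M" for s
    using gain_le_opt_gain[OF \<sigma>, of s] le_m that by (meson order_antisym order_trans)
  then show ?thesis by blast
qed

end


section \<open>Concentration of the sampling error\<close>

text \<open>A union bound across a bind: the conditional probability is bounded by 1 on B and by e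
  elsewhere.\<close>

lemma emeasure_bind_pmf_le:
  assumes "\<And>x. x \<in> set_pmf p \<Longrightarrow> x \<notin> B \<Longrightarrow> emeasure (measure_pmf (f x)) X \<le> e x"
  shows "emeasure (measure_pmf (bind_pmf p f)) X \<le> emeasure (measure_pmf p) B + (\<integral>\<^sup>+x. e x \<partial>p)"
proof -
  have "emeasure (measure_pmf (bind_pmf p f)) X = (\<integral>\<^sup>+x. emeasure (measure_pmf (f x)) X \<partial>p)"
    by simp
  also have "\<dots> \<le> (\<integral>\<^sup>+x. indicator B x + e x \<partial>p)"
  proof (rule nn_integral_mono_AE, unfold AE_measure_pmf_iff, intro ballI)
    fix x assume x: "x \<in> set_pmf p"
    show "emeasure (measure_pmf (f x)) X \<le> indicator B x + e x"
    proof (cases "x \<in> B")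
      case True
      have "emeasure (measure_pmf (f x)) X \<le> 1" by (rule measure_pmf.emeasure_le_1)
      also have "1 \<le> 1 + e x" by simp
      finally show ?thesis using True by simp
    next
      case False
      then show ?thesis using assms[OF x] by simp
    qed
  qed
  also have "\<dots> = emeasure (measure_pmf p) B + (\<integral>\<^sup>+x. e x \<partial>p)"
    by (simp add: nn_integral_add)
  finally show ?thesis .
qed

lemma measure_bind_pmf_le_const:
  assumes "\<And>x. x \<in> set_pmf p \<Longrightarrow> x \<notin> B \<Longrightarrow> measure_pmf.prob (f x) X \<le> c" and "0 \<le> c"
  shows "measure_pmf.prob (bind_pmf p f) X \<le> measure_pmf.prob p B + c"
proof -
  have "emeasure (measure_pmf (bind_pmf p f)) X
      \<le> emeasure (measure_pmf p) B + (\<integral>\<^sup>+x. ennreal c \<partial>p)"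
    by (rule emeasure_bind_pmf_le) (simp add: assms measure_pmf.emeasure_eq_measure ennreal_leI)
  then have "ennreal (measure_pmf.prob (bind_pmf p f) X) \<le> ennreal (measure_pmf.prob p B + c)"
    using assms(2)
    by (simp add: measure_pmf.emeasure_eq_measure measure_pmf.emeasure_space_1
        del: emeasure_bind_pmf)
  then show ?thesis using assms(2) by (subst (asm) ennreal_le_iff) auto
qed

text \<open>Y is measured under the unconditioned law of the next state. Concentration can therefore
  be proved for the whole process, without conditioning on the invariant.\<close>

lemma measure_bind_pmf_le:
  assumes "\<And>x y. x \<in> set_pmf p \<Longrightarrow> x \<notin> B \<Longrightarrow> y \<in> set_pmf (f x) \<Longrightarrow> y \<in> X \<Longrightarrow> y \<in> Y"
  shows "measure_pmf.prob (bind_pmf p f) X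
    \<le> measure_pmf.prob p B + measure_pmf.prob (bind_pmf p f) Y"
proof -
  have "emeasure (measure_pmf (bind_pmf p f)) X
      \<le> emeasure (measure_pmf p) B + (\<integral>\<^sup>+x. emeasure (measure_pmf (f x)) Y \<partial>p)"
    by (rule emeasure_bind_pmf_le, rule emeasure_mono_AE) (use assms in \<open>auto simp: AE_measure_pmf_iff\<close>)
  also have "(\<integral>\<^sup>+x. emeasure (measure_pmf (f x)) Y \<partial>p) = emeasure (measure_pmf (bind_pmf p f)) Y"
    by simp
  finally have "ennreal (measure_pmf.prob (bind_pmf p f) X)
      \<le> ennreal (measure_pmf.prob p B + measure_pmf.prob (bind_pmf p f) Y)"
    by (simp add: measure_pmf.emeasure_eq_measure del: emeasure_bind_pmf)
  then show ?thesis by (subst (asm) ennreal_le_iff) auto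
qed

text \<open>Negative l, which the lower tail requires, is reduced to positive l by passing from d to
  -d.\<close>

lemma hoeffding_pmf:
  assumes "\<And>x. x \<in> set_pmf p \<Longrightarrow> d x \<in> {a..b}"
  shows "(\<integral>\<^sup>+x. ennreal (exp (l * (d x - measure_pmf.expectation p d))) \<partial>p)
    \<le> ennreal (exp (l\<^sup>2 * (b - a)\<^sup>2 / 8))"
proof -
  have pos: "(\<integral>\<^sup>+x. ennreal (exp (l * (d x - measure_pmf.expectation p d))) \<partial>p)
      \<le> ennreal (exp (l\<^sup>2 * (b - a)\<^sup>2 / 8))"
    if "\<And>x. x \<in> set_pmf p \<Longrightarrow> d x \<in> {a..b}" "0 < l" for d :: "_ \<Rightarrow> real" and a b l
  proof -
    interpret interval_bounded_random_variable "measure_pmf p" d a b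
      by unfold_locales (use that(1) in \<open>auto simp: AE_measure_pmf_iff\<close>)
    show ?thesis by (rule Hoeffdings_lemma_nn_integral[OF that(2)])
  qed
  consider "l = 0" | "0 < l" | "0 < - l" by linarith
  then show ?thesis
  proof cases
    case 1
    then show ?thesis by (simp add: measure_pmf.emeasure_space_1)
  next
    case 2
    then show ?thesis using pos[of d a b l] assms by blast
  next
    case 3
    have "(\<integral>\<^sup>+x. ennreal (exp (- l * (- d x - measure_pmf.expectation p (\<lambda>x. - d x)))) \<partial>p)
      \<le> ennreal (exp ((- l)\<^sup>2 * (- a - - b)\<^sup>2 / 8))"
      by (rule pos) (use assms 3 in auto)
    then show ?thesis by (simp add: algebra_simps)
  qed
qed

context mdp_context
begin

lemma expectation_kernel:
  fixes d :: "'s \<Rightarrow> real"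
  assumes "s \<in> states M" "a \<in> actions M"
  shows "measure_pmf.expectation (kernel M s a) d = (\<Sum>u\<in>states M. pmf (kernel M s a) u * d u)"
  using set_kernel[OF assms] finite_states
  by (subst integral_measure_pmf_real[of "states M"]) (auto simp: mult.commute)

text \<open>\<open>D s a\<close> involves only the m coordinates (s, a, j). Padding with factors 1
  gives a product over all coordinates, which independence splits; m Hoeffding bounds at l / m then
  leave one power of m in the denominator.\<close>

lemma sample_mgf:
  assumes sa: "s \<in> states M" "a \<in> actions M" and m: "1 \<le> m"
  shows "(\<integral>\<^sup>+D. ennreal (exp (l * (D s a - (\<Sum>u\<in>states M. pmf (kernel M s a) u * d u)))) \<partial>sample M d m)
    \<le> ennreal (exp (l\<^sup>2 * (sp_state M d)\<^sup>2 / (8 * real m)))"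
proof -
  let ?I = "states M \<times> actions M \<times> {..<m}" and ?J = "(\<lambda>j. (s, a, j)) ` {..<m}"
  let ?K = "\<lambda>(s, a, j). kernel M s a"
  let ?\<mu> = "\<Sum>u\<in>states M. pmf (kernel M s a) u * d u"
  define g where "g x = ennreal (exp (l / real m * (d x - ?\<mu>)))" for x
  define f where "f i x = (if i \<in> ?J then g x else 1)" for i :: "'s \<times> 'a \<times> nat" and x
  have fin: "finite ?I" using finite_states finite_actions by simp
  have JI: "?J \<subseteq> ?I" using sa by auto
  have inj: "inj_on (\<lambda>j. (s, a, j)) {..<m}" by (auto simp: inj_on_def)
  have prod_J: "(\<Prod>i\<in>?I. if i \<in> ?J then F i else 1) = (\<Prod>j<m. F (s, a, j))"
    for F :: "'s \<times> 'a \<times> nat \<Rightarrow> ennreal"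
  proof -
    have "(\<Prod>i\<in>?I. if i \<in> ?J then F i else 1) = prod F (?I \<inter> ?J)"
      by (rule prod.inter_restrict[OF fin, symmetric])
    also have "?I \<inter> ?J = ?J" using JI by blast
    also have "prod F ?J = (\<Prod>j<m. F (s, a, j))" using prod.reindex[OF inj, of F] by simp
    finally show ?thesis .
  qed
  have "(\<integral>\<^sup>+D. ennreal (exp (l * (D s a - ?\<mu>))) \<partial>sample M d m)
      = (\<integral>\<^sup>+X. ennreal (exp (l * (1 / real m * (\<Sum>j<m. d (X (s, a, j))) - ?\<mu>))) \<partial>Pi_pmf ?I undefined ?K)"
    by (simp add: sample_def)
  also have "\<dots> = (\<integral>\<^sup>+X. (\<Prod>i\<in>?I. f i (X i)) \<partial>Pi_pmf ?I undefined ?K)"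
  proof (rule nn_integral_cong)
    fix X :: "'s \<times> 'a \<times> nat \<Rightarrow> 's"
    have "l * (1 / real m * (\<Sum>j<m. d (X (s, a, j))) - ?\<mu>) = (\<Sum>j<m. l / real m * (d (X (s, a, j)) - ?\<mu>))"
      using m by (simp add: sum_subtractf right_diff_distrib sum_distrib_left sum_divide_distrib)
    then have "ennreal (exp (l * (1 / real m * (\<Sum>j<m. d (X (s, a, j))) - ?\<mu>))) = (\<Prod>j<m. g (X (s, a, j)))"
      by (simp only: exp_sum[OF finite_lessThan] g_def prod_ennreal[OF exp_ge_zero])
    then show "ennreal (exp (l * (1 / real m * (\<Sum>j<m. d (X (s, a, j))) - ?\<mu>))) = (\<Prod>i\<in>?I. f i (X i))"
      unfolding f_def by (simp only: prod_J)
  qed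
  also have "\<dots> = (\<Prod>i\<in>?I. \<integral>\<^sup>+x. f i x \<partial>?K i)"
    by (rule nn_integral_prod_Pi_pmf[OF fin])
  also have "\<dots> = (\<Prod>i\<in>?I. if i \<in> ?J then (\<integral>\<^sup>+x. g x \<partial>?K i) else 1)"
    by (intro prod.cong refl) (auto simp: f_def measure_pmf.emeasure_space_1)
  also have "\<dots> = (\<Prod>j<m. \<integral>\<^sup>+x. g x \<partial>kernel M s a)" by (simp only: prod_J prod.case)
  also have "\<dots> \<le> (\<Prod>j<m. ennreal (exp ((l / real m)\<^sup>2 * (sp_state M d)\<^sup>2 / 8)))"
  proof (rule prod_mono_ennreal)
    have "d x \<in> {Min (d ` states M)..Max (d ` states M)}" if "x \<in> set_pmf (kernel M s a)" for x
      using that set_kernel[OF sa] finite_states by auto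
    from hoeffding_pmf[of "kernel M s a" d, OF this, of "l / real m"]
    show "(\<integral>\<^sup>+x. g x \<partial>kernel M s a) \<le> ennreal (exp ((l / real m)\<^sup>2 * (sp_state M d)\<^sup>2 / 8))"
      by (simp add: g_def expectation_kernel[OF sa] sp_state_def sp_norm_def)
  qed
  also have "\<dots> = ennreal (exp (l\<^sup>2 * (sp_state M d)\<^sup>2 / (8 * real m)))"
    using m by (simp add: ennreal_power exp_of_nat_mult[symmetric] power2_eq_square field_simps)
  finally show ?thesis .
qed

text \<open>For \<open>h = max_act M Q\<close> this is T - T(Q). Expressed through h, it vanishes at
  the initial h = 0, T = r, and each iteration adds the centred term D - P d.\<close>

definition sampling_error :: "('s \<Rightarrow> real) \<Rightarrow> ('s \<Rightarrow> 'a \<Rightarrow> real) \<Rightarrow> 's \<Rightarrow> 'a \<Rightarrow> real" where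
  "sampling_error h T s a = T s a - reward M s a - (\<Sum>u\<in>states M. pmf (kernel M s a) u * h u)"

text \<open>d and m are random, but m >= \<alpha> c_k sp(d)^2 / \<epsilon>^2 bounds the conditional
  moment of D - P d by a factor independent of the past. It can be pulled out of the outer integral,
  and the factors multiply to the sum of 1 / c_i in the exponent.\<close>

lemma savia_iter_mgf:
  assumes sa: "s \<in> states M" "a \<in> actions M"
    and pos: "0 < \<epsilon>" "0 < \<alpha>" "\<And>i. 0 < c i"
  shows "(\<integral>\<^sup>+(Q, h, T, N). ennreal (exp (l * sampling_error h T s a)) \<partial>savia_iter M c \<beta> Q0 \<epsilon> \<alpha> k)
    \<le> ennreal (exp (l\<^sup>2 * \<epsilon>\<^sup>2 / (8 * \<alpha>) * (\<Sum>i<k. 1 / c i)))"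
proof (induction k)
  case 0
  then show ?case by (simp add: sampling_error_def)
next
  case (Suc k)
  define v where "v = l\<^sup>2 * \<epsilon>\<^sup>2 / (8 * \<alpha>)"
  let ?P = "\<lambda>d. \<Sum>u\<in>states M. pmf (kernel M s a) u * d u"
  have step: "(\<integral>\<^sup>+D. ennreal (exp (l * sampling_error h (\<lambda>s a. T s a + D s a) s a)) \<partial>sample M d m)
      \<le> ennreal (exp (v / c k)) * ennreal (exp (l * sampling_error h' T s a))"
    if d: "d = (\<lambda>s. h s - h' s)" and m: "m = max (nat \<lceil>\<alpha> * c k * (sp_state M d)\<^sup>2 / \<epsilon>\<^sup>2\<rceil>) 1"
    for h h' T m d
  proof -
    have err: "sampling_error h (\<lambda>s a. T s a + D s a) s a = (D s a - ?P d) + sampling_error h' T s a" for D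
      by (simp add: sampling_error_def d right_diff_distrib sum_subtractf)
    have "(\<integral>\<^sup>+D. ennreal (exp (l * sampling_error h (\<lambda>s a. T s a + D s a) s a)) \<partial>sample M d m)
      = (\<integral>\<^sup>+D. ennreal (exp (l * (D s a - ?P d))) * ennreal (exp (l * sampling_error h' T s a)) \<partial>sample M d m)"
      by (simp add: err ring_distribs exp_add ennreal_mult')
    also have "\<dots> = (\<integral>\<^sup>+D. ennreal (exp (l * (D s a - ?P d))) \<partial>sample M d m)
        * ennreal (exp (l * sampling_error h' T s a))"
      by (rule nn_integral_multc) simp
    also have "\<dots> \<le> ennreal (exp (v / c k)) * ennreal (exp (l * sampling_error h' T s a))"
    proof (rule mult_right_mono)
      have m1: "1 \<le> m" by (simp add: m)
      have "\<alpha> * c k * (sp_state M d)\<^sup>2 / \<epsilon>\<^sup>2 \<le> real m"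
        unfolding m by linarith
      then have "(sp_state M d)\<^sup>2 / real m \<le> \<epsilon>\<^sup>2 / (\<alpha> * c k)"
        using m1 pos(1,2) pos(3)[of k] by (simp add: field_simps)
      then have "l\<^sup>2 / 8 * ((sp_state M d)\<^sup>2 / real m) \<le> l\<^sup>2 / 8 * (\<epsilon>\<^sup>2 / (\<alpha> * c k))"
        by (rule mult_left_mono) simp
      then have "l\<^sup>2 * (sp_state M d)\<^sup>2 / (8 * real m) \<le> v / c k" by (simp add: v_def mult_ac)
      then have "ennreal (exp (l\<^sup>2 * (sp_state M d)\<^sup>2 / (8 * real m))) \<le> ennreal (exp (v / c k))"
        by (intro ennreal_leI) simp
      then show "(\<integral>\<^sup>+D. ennreal (exp (l * (D s a - ?P d))) \<partial>sample M d m) \<le> ennreal (exp (v / c k))"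
        by (rule order_trans[OF sample_mgf[OF sa m1]])
    qed simp
    finally show ?thesis .
  qed
  have "(\<integral>\<^sup>+(Q, h, T, N). ennreal (exp (l * sampling_error h T s a)) \<partial>savia_iter M c \<beta> Q0 \<epsilon> \<alpha> (Suc k))
    \<le> (\<integral>\<^sup>+(Q, h, T, N). ennreal (exp (v / c k)) * ennreal (exp (l * sampling_error h T s a))
        \<partial>savia_iter M c \<beta> Q0 \<epsilon> \<alpha> k)"
    unfolding savia_iter.simps(2) nn_integral_bind_pmf
  proof (rule nn_integral_mono, clarify)
    fix Q T N and h' :: "'s \<Rightarrow> real"
    show "(\<integral>\<^sup>+y. (case y of (Q, h, T, N) \<Rightarrow> ennreal (exp (l * sampling_error h T s a)))
        \<partial>(let b = if k = 0 then 0 else \<beta> k; Q = \<lambda>s a. (1 - b) * Q0 s a + b * T s a; h = max_act M Q;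
            d = \<lambda>s. h s - h' s; m = max (nat \<lceil>\<alpha> * c k * (sp_state M d)\<^sup>2 / \<epsilon>\<^sup>2\<rceil>) 1
          in map_pmf (\<lambda>D. (Q, h, \<lambda>s a. T s a + D s a, N + card (states M) * card (actions M) * m)) (sample M d m)))
      \<le> ennreal (exp (v / c k)) * ennreal (exp (l * sampling_error h' T s a))"
      unfolding Let_def nn_integral_map_pmf prod.case by (rule step[OF refl refl])
  qed
  also have "\<dots> = ennreal (exp (v / c k)) *
      (\<integral>\<^sup>+(Q, h, T, N). ennreal (exp (l * sampling_error h T s a)) \<partial>savia_iter M c \<beta> Q0 \<epsilon> \<alpha> k)"
    by (simp add: split_beta' nn_integral_cmult)
  also have "\<dots> \<le> ennreal (exp (v / c k)) * ennreal (exp (v * (\<Sum>i<k. 1 / c i)))"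
    unfolding v_def by (rule mult_left_mono[OF Suc.IH]) simp
  also have "\<dots> = ennreal (exp (v * (\<Sum>i<Suc k. 1 / c i)))"
    by (simp add: ennreal_mult'[symmetric] exp_add[symmetric] algebra_simps)
  finally show ?case by (simp only: v_def)
qed

lemma savia_iter_tail:
  assumes sa: "s \<in> states M" "a \<in> actions M"
    and pos: "0 < \<epsilon>" "0 < \<alpha>" "\<And>i. 0 < c i" and sum: "(\<Sum>i<k. 1 / c i) \<le> 2"
    and \<sigma>: "\<sigma> = 1 \<or> \<sigma> = - 1"
  shows "measure_pmf.prob (savia_iter M c \<beta> Q0 \<epsilon> \<alpha> k) {(Q, h, T, N). \<epsilon> < \<sigma> * sampling_error h T s a}
    \<le> exp (- \<alpha>)"
proof -
  let ?X = "{(Q, h, T, N). \<epsilon> < \<sigma> * sampling_error h T s a}"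
  let ?p = "savia_iter M c \<beta> Q0 \<epsilon> \<alpha> k"
  \<comment> \<open>The minimiser of the Chernoff exponent when the sum of 1 / c_i equals 2; the
    exponent is then -2 \<alpha> + \<alpha>. The sign \<sigma> covers both tails.\<close>
  define l where "l = 2 * \<alpha> / \<epsilon>"
  have l: "0 < l" using pos by (simp add: l_def)
  have "emeasure (measure_pmf ?p) ?X = (\<integral>\<^sup>+x. indicator ?X x \<partial>?p)" by simp
  also have "\<dots> \<le> (\<integral>\<^sup>+(Q, h, T, N). ennreal (exp (- l * \<epsilon>)) * ennreal (exp ((l * \<sigma>) * sampling_error h T s a)) \<partial>?p)"
  proof (rule nn_integral_mono, clarsimp simp: indicator_def)
    fix h T assume "\<epsilon> < \<sigma> * sampling_error h T s a"
    then have "l * \<epsilon> \<le> l * (\<sigma> * sampling_error h T s a)" using l by (intro mult_left_mono) auto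
    then have "1 \<le> exp (- l * \<epsilon> + (l * \<sigma>) * sampling_error h T s a)" by (simp add: mult.assoc)
    then have "ennreal 1 \<le> ennreal (exp (- l * \<epsilon>) * exp ((l * \<sigma>) * sampling_error h T s a))"
      unfolding exp_add by (rule ennreal_leI)
    then show "1 \<le> ennreal (exp (- (l * \<epsilon>))) * ennreal (exp (l * \<sigma> * sampling_error h T s a))"
      by (simp add: ennreal_mult')
  qed
  also have "\<dots> = ennreal (exp (- l * \<epsilon>)) *
      (\<integral>\<^sup>+(Q, h, T, N). ennreal (exp ((l * \<sigma>) * sampling_error h T s a)) \<partial>?p)"
    by (simp add: split_beta' nn_integral_cmult)
  also have "\<dots> \<le> ennreal (exp (- l * \<epsilon>)) * ennreal (exp ((l * \<sigma>)\<^sup>2 * \<epsilon>\<^sup>2 / (8 * \<alpha>) * (\<Sum>i<k. 1 / c i)))"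
    by (rule mult_left_mono[OF savia_iter_mgf[OF sa pos]]) simp
  also have "\<dots> = ennreal (exp (- l * \<epsilon> + (l * \<sigma>)\<^sup>2 * \<epsilon>\<^sup>2 / (8 * \<alpha>) * (\<Sum>i<k. 1 / c i)))"
    by (simp only: exp_add ennreal_mult'[OF exp_ge_zero])
  also have "\<dots> \<le> ennreal (exp (- \<alpha>))"
  proof (intro ennreal_leI, subst exp_le_cancel_iff)
    have eq: "(l * \<sigma>)\<^sup>2 * \<epsilon>\<^sup>2 / (8 * \<alpha>) = \<alpha> / 2"
      using pos \<sigma> by (auto simp: l_def power2_eq_square field_simps)
    have "\<alpha> / 2 * (\<Sum>i<k. 1 / c i) \<le> \<alpha> / 2 * 2" using pos sum by (intro mult_left_mono) auto
    moreover have "- l * \<epsilon> = - 2 * \<alpha>" using pos by (simp add: l_def)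
    ultimately show "- l * \<epsilon> + (l * \<sigma>)\<^sup>2 * \<epsilon>\<^sup>2 / (8 * \<alpha>) * (\<Sum>i<k. 1 / c i) \<le> - \<alpha>"
      unfolding eq by linarith
  qed
  finally show ?thesis by (simp add: measure_pmf.emeasure_eq_measure)
qed

lemma savia_iter_concentration:
  assumes pos: "0 < \<epsilon>" "0 < \<alpha>" "\<And>i. 0 < c i" and sum: "(\<Sum>i<k. 1 / c i) \<le> 2"
  shows "measure_pmf.prob (savia_iter M c \<beta> Q0 \<epsilon> \<alpha> k)
      {(Q, h, T, N). \<exists>s\<in>states M. \<exists>a\<in>actions M. \<epsilon> < \<bar>sampling_error h T s a\<bar>}
    \<le> 2 * real (card (states M)) * real (card (actions M)) * exp (- \<alpha>)"
proof -
  let ?I = "states M \<times> actions M \<times> {1, - 1 :: real}"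
  let ?E = "\<lambda>(s, a, \<sigma>). {(Q :: 's \<Rightarrow> 'a \<Rightarrow> real, h, T, N :: nat). \<epsilon> < \<sigma> * sampling_error h T s a}"
  let ?p = "savia_iter M c \<beta> Q0 \<epsilon> \<alpha> k"
  have "{(Q, h, T, N). \<exists>s\<in>states M. \<exists>a\<in>actions M. \<epsilon> < \<bar>sampling_error h T s a\<bar>} \<subseteq> (\<Union>i\<in>?I. ?E i)"
    by (fastforce simp: abs_real_def split: if_splits)
  then have "measure_pmf.prob ?p {(Q, h, T, N). \<exists>s\<in>states M. \<exists>a\<in>actions M. \<epsilon> < \<bar>sampling_error h T s a\<bar>}
      \<le> measure_pmf.prob ?p (\<Union>i\<in>?I. ?E i)"
    by (intro measure_pmf.finite_measure_mono) auto
  also have "\<dots> \<le> (\<Sum>i\<in>?I. measure_pmf.prob ?p (?E i))"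
    using finite_states finite_actions by (intro measure_UNION_le) auto
  also have "\<dots> \<le> (\<Sum>i\<in>?I. exp (- \<alpha>))"
  proof (rule sum_mono)
    fix i assume "i \<in> ?I"
    then obtain s a \<sigma> where "i = (s, a, \<sigma>)" "s \<in> states M" "a \<in> actions M" "\<sigma> = 1 \<or> \<sigma> = - 1" by auto
    then show "measure_pmf.prob ?p (?E i) \<le> exp (- \<alpha>)"
      using savia_iter_tail[OF _ _ pos sum, of s a \<sigma>] by simp
  qed
  also have "\<dots> = 2 * real (card (states M)) * real (card (actions M)) * exp (- \<alpha>)"
    by (simp add: card_cartesian_product)
  finally show ?thesis .
qed

end

section \<open>Summability of the weights 1 / c_k\<close>

lemma c_seq_pos: "0 < c_seq k"
proof -
  have "0 < ln (real k + 2)" by (intro ln_gt_zero) simp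
  then show ?thesis by (simp add: c_seq_def)
qed

text \<open>Comparison with the telescoping sum of \<open>1 / ln (i + 1) - 1 / ln (i + 2)\<close>.\<close>

lemma sum_inverse_c_seq_le: "(\<Sum>i<k. 1 / c_seq i) \<le> 1"
proof -
  have ln2: "2 / 3 \<le> ln (2 :: real)" by (rule ln2_ge_two_thirds)
  \<comment> \<open>The term i = 0 stays apart, since ln 1 = 0 rules out its telescoping comparison.
    With ln 2 at least 2 / 3 the constant is at most 9 / 8 + 3 / 2, which the factor 5
    absorbs.\<close>
  have bound: "5 * (\<Sum>i<Suc k. 1 / c_seq i) \<le> 1 / (2 * (ln 2)\<^sup>2) + 1 / ln 2 - 1 / ln (real k + 2)" for k
  proof (induction k)
    case 0
    then show ?case by (simp add: c_seq_def)
  next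
    case (Suc k)
    define a where "a = ln (real k + 2)"
    define b where "b = ln (real k + 3)"
    have a: "0 < a" unfolding a_def by (intro ln_gt_zero) simp
    have ab: "a \<le> b" unfolding a_def b_def by simp
    have "ln (real k + 2) - ln (real k + 3) \<le> (real k + 2 - (real k + 3)) / (real k + 3)"
      by (rule ln_diff_le) auto
    then have diff: "1 / (real k + 3) \<le> b - a" by (simp add: a_def b_def)
    have "real (Suc k) + 2 = real k + 3" by simp
    then have "c_seq (Suc k) = 5 * (real k + 3) * (b * b)"
      by (simp only: c_seq_def b_def power2_eq_square)
    then have "5 * (1 / c_seq (Suc k)) = (1 / (real k + 3)) / (b * b)"
      by (simp only: mult.assoc) (simp add: divide_simps del: distrib_left_numeral)
    also have "\<dots> \<le> (b - a) / (a * b)"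
      using diff a ab by (intro frac_le mult_right_mono) auto
    also have "\<dots> = 1 / a - 1 / b" using a ab by (simp add: field_simps)
    finally have "5 * (1 / c_seq (Suc k)) \<le> 1 / ln (real k + 2) - 1 / ln (real (Suc k) + 2)"
      by (simp add: a_def b_def add.commute)
    then show ?case using Suc.IH by (simp add: algebra_simps)
  qed
  have "1 / (2 * (ln 2)\<^sup>2) \<le> 1 / (2 * (2 / 3 :: real)\<^sup>2)"
    using ln2 by (intro divide_left_mono mult_left_mono power_mono mult_pos_pos) auto
  moreover have "1 / ln 2 \<le> 1 / (2 / 3 :: real)" using ln2 by (intro divide_left_mono) auto
  ultimately have const: "1 / (2 * (ln 2)\<^sup>2) + 1 / ln 2 \<le> (3 :: real)" by (simp add: power2_eq_square)
  show ?thesis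
  proof (cases k)
    case (Suc j)
    have "0 \<le> 1 / ln (real j + 2)" by simp
    with bound[of j] const show ?thesis unfolding Suc by linarith
  qed simp
qed


section \<open>The anchored value iteration\<close>

lemma \<beta>_seq_bounds: "0 \<le> \<beta>_seq k" "\<beta>_seq k \<le> 1" "\<beta>_seq (k - 1) \<le> \<beta>_seq k"
  by (cases k; simp add: \<beta>_seq_def field_simps)+

context mdp_context
begin

text \<open>Empirical means of d stay within the range of d. This holds surely, so the span of T^k -
  T^(k-1) is controlled by that of d^k without any sampling error.\<close>

lemma sp_sample_le:
  assumes "D \<in> set_pmf (sample M d m)" "1 \<le> m"
  shows "sp_mat M D \<le> sp_state M d"
proof -
  let ?l = "Min (d ` states M)" and ?u = "Max (d ` states M)"
  let ?I = "states M \<times> actions M \<times> {..<m}"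
  obtain X where X: "X \<in> set_pmf (Pi_pmf ?I undefined (\<lambda>(s, a, j). kernel M s a))"
    and D: "D = (\<lambda>s a. (1 / real m) * (\<Sum>j<m. d (X (s, a, j))))"
    using assms(1) by (auto simp: sample_def)
  have fin: "finite ?I" using finite_states finite_actions by simp
  have X_in: "X (s, a, j) \<in> states M" if "s \<in> states M" "a \<in> actions M" "j < m" for s a j
  proof -
    have "X (s, a, j) \<in> set_pmf (kernel M s a)"
      using X that unfolding set_Pi_pmf[OF fin] PiE_dflt_def by force
    then show ?thesis using set_kernel that by blast
  qed
  have D_bounds: "?l \<le> D s a \<and> D s a \<le> ?u" if "s \<in> states M" "a \<in> actions M" for s a
  proof -
    have "(\<Sum>j<m. d (X (s, a, j))) \<le> (\<Sum>j<m. ?u)" "(\<Sum>j<m. ?l) \<le> (\<Sum>j<m. d (X (s, a, j)))"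
      using X_in[OF that] finite_states by (auto intro!: sum_mono Max_ge Min_le simp del: sum_constant)
    then show ?thesis using assms(2) by (simp add: D field_simps)
  qed
  show ?thesis
  proof (rule sp_mat_leI)
    fix s a t b assume "s \<in> states M" "a \<in> actions M" "t \<in> states M" "b \<in> actions M"
    then show "D s a - D t b \<le> sp_state M d"
      using D_bounds[of s a] D_bounds[of t b] by (simp add: sp_state_def sp_norm_def)
  qed
qed

lemma sp_state_cong:
  assumes "\<And>s. s \<in> states M \<Longrightarrow> h s = h' s" shows "sp_state M h = sp_state M h'"
  unfolding sp_state_def sp_norm_def
  by (intro arg_cong2[where f = minus] arg_cong[where f = Max] arg_cong[where f = Min] image_cong)
     (use assms in auto)

lemma bellman_sampling_error:
  assumes "\<And>s. s \<in> states M \<Longrightarrow> h s = max_act M Q s"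
  shows "T s a = bellman M Q s a + sampling_error h T s a"
  using assms by (simp add: bellman_def sampling_error_def)

end

section \<open>The invariant of a single run\<close>

locale savia_context = mdp_context M for M :: "('s, 'a) mdp" +
  fixes Qs :: "'s \<Rightarrow> 'a \<Rightarrow> real" and g :: real
  assumes reward_bounds: "\<And>s a. s \<in> states M \<Longrightarrow> a \<in> actions M \<Longrightarrow> 0 \<le> reward M s a \<and> reward M s a \<le> 1"
    and bellman_Qs: "\<And>s a. s \<in> states M \<Longrightarrow> a \<in> actions M \<Longrightarrow> bellman M Qs s a = Qs s a + g"
    and sp_ge_1: "1 \<le> sp_state M (max_act M Qs)"
begin

definition H :: real where "H = sp_state M (max_act M Qs)"

definition SA :: real where "SA = real (card (states M)) * real (card (actions M))"

lemma H_ge_1: "1 \<le> H" using sp_ge_1 by (simp add: H_def)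

lemma SA_ge_1: "1 \<le> SA"
proof -
  have "1 \<le> card (states M) * card (actions M)"
    using finite_states states_nonempty finite_actions actions_nonempty
    by (simp add: Suc_le_eq card_gt_0_iff)
  then show ?thesis unfolding SA_def by (metis of_nat_1 of_nat_le_iff of_nat_mult)
qed

lemma sp_reward_le: "sp_mat M (reward M) \<le> 1"
  using reward_bounds by (intro sp_mat_leI) (smt (verit))

text \<open>By the Bellman equation r - Q* is the constant g minus the kernel averages of h*, which
  spread no more than h* does.\<close>

lemma sp_reward_Qs_le: "sp_mat M (\<lambda>s a. reward M s a - Qs s a) \<le> H"
proof (rule sp_mat_leI)
  fix s a t b assume A: "s \<in> states M" "a \<in> actions M" "t \<in> states M" "b \<in> actions M"
  then show "reward M s a - Qs s a - (reward M t b - Qs t b) \<le> H"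
    using bellman_Qs[OF A(1,2)] bellman_Qs[OF A(3,4)] kernel_diff_le[OF A(3,4,1,2), of "max_act M Qs"]
    by (simp add: bellman_def H_def)
qed

lemma sp_Qs_le: "sp_mat M Qs \<le> H + 1"
proof -
  have "Qs = (\<lambda>s a. reward M s a - (reward M s a - Qs s a))" by simp
  then have "sp_mat M Qs \<le> sp_mat M (reward M) + sp_mat M (\<lambda>s a. reward M s a - Qs s a)"
    using sp_mat_diff_le by metis
  then show ?thesis using sp_reward_le sp_reward_Qs_le by linarith
qed

text \<open>Bounds the batch size m_k on the good event; the leading 1 absorbs both the ceiling and
  the maximum with 1.\<close>

definition sample_bound :: "real \<Rightarrow> real \<Rightarrow> nat \<Rightarrow> real" where
  "sample_bound \<epsilon> \<alpha> k = 1 + \<alpha> * c_seq k * (8 * H / (real k + 2) + \<epsilon>)\<^sup>2 / \<epsilon>\<^sup>2"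

text \<open>
  \<open>T'\<close> is the matrix \<open>T\<^sup>k\<^sup>-\<^sup>2\<close> from which \<open>Q = Q\<^sup>k\<^sup>-\<^sup>1\<close> was formed, while \<open>T = T\<^sup>k\<^sup>-\<^sup>1\<close>.  For \<open>k = 0\<close>
  the truncated index \<open>k - 1 = 0\<close> and \<open>\<beta>\<^sub>0 = 0\<close> make the first clause hold with \<open>T' = r\<close>.
\<close>

definition invariant ::
  "real \<Rightarrow> real \<Rightarrow> nat \<Rightarrow> (('s \<Rightarrow> 'a \<Rightarrow> real) \<times> ('s \<Rightarrow> real) \<times> ('s \<Rightarrow> 'a \<Rightarrow> real) \<times> nat) set" where
  "invariant \<epsilon> \<alpha> k = {(Q, h, T, N). \<exists>T'.
     (\<forall>s\<in>states M. \<forall>a\<in>actions M. Q s a = \<beta>_seq (k - 1) * T' s a) \<and>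
     (\<forall>s\<in>states M. h s = max_act M Q s) \<and>
     (\<forall>s\<in>states M. \<forall>a\<in>actions M. \<bar>sampling_error h T s a\<bar> \<le> \<epsilon>) \<and>
     sp_mat M (\<lambda>s a. T s a - T' s a) \<le> 8 * H / (real k + 1) + \<epsilon> \<and>
     sp_mat M (\<lambda>s a. T s a - Qs s a) \<le> H + 1 + \<epsilon> * (real k + 1) \<and>
     sp_mat M T' \<le> 4 * H + \<epsilon> * real k \<and>
     real N \<le> SA * (\<Sum>i<k. sample_bound \<epsilon> \<alpha> i)}"

lemma invariant_0:
  assumes "0 < \<epsilon>"
  shows "((\<lambda>s a. 0), (\<lambda>s. 0), reward M, 0) \<in> invariant \<epsilon> \<alpha> 0"
proof -
  have "max_act M (\<lambda>s a. 0) s = 0" for s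
    by (metis max_act_attained)
  moreover have "sp_mat M (\<lambda>s a. 0) \<le> 0" using sp_mat_abs_le[of "\<lambda>s a. 0" 0] by simp
  ultimately show ?thesis
    unfolding invariant_def using sp_reward_le sp_reward_Qs_le H_ge_1 assms
    by (auto simp: \<beta>_seq_def sampling_error_def intro!: exI[of _ "reward M"])
qed

text \<open>For k >= 1 the weights grow by 2 / ((k + 1) (k + 2)). With 8 H = 2 * 4 H the H terms
  close up exactly to 8 H / (k + 2), and the \<epsilon> terms carry a factor below 1, so noise does
  not accumulate in the increments.\<close>

lemma increment_arith:
  assumes "0 < \<epsilon>"
  shows "\<beta>_seq k * (8 * H / (real k + 1) + \<epsilon>) + (\<beta>_seq k - \<beta>_seq (k - 1)) * (4 * H + \<epsilon> * real k)
    \<le> 8 * H / (real k + 2) + \<epsilon>"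
proof (cases k)
  case 0
  then show ?thesis using assms H_ge_1 by (simp add: \<beta>_seq_def)
next
  case (Suc j)
  define x where "x = real k"
  have x: "1 \<le> x" using Suc by (simp add: x_def)
  have diff: "\<beta>_seq k - \<beta>_seq (k - 1) = 2 / ((x + 1) * (x + 2))"
    using Suc by (simp add: \<beta>_seq_def x_def field_simps)
  have "\<beta>_seq k * (8 * H / (x + 1) + \<epsilon>) + 2 / ((x + 1) * (x + 2)) * (4 * H + \<epsilon> * x)
      = 8 * H / (x + 2) + \<epsilon> * ((x * x + 3 * x) / (x * x + 3 * x + 2))"
  proof -
    have \<beta>: "\<beta>_seq k = x / (x + 2)" by (simp add: \<beta>_seq_def x_def)
    have ne: "x + 1 \<noteq> 0" "x + 2 \<noteq> 0" using x by auto
    have den: "x * x + 3 * x + 2 = (x + 1) * (x + 2)" by (simp add: algebra_simps)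
    have "\<beta>_seq k * (8 * H / (x + 1) + \<epsilon>) + 2 / ((x + 1) * (x + 2)) * (4 * H + \<epsilon> * x)
      = (8 * H * (x + 1) + \<epsilon> * (x * x + 3 * x)) / ((x + 1) * (x + 2))"
      unfolding \<beta> using ne by (simp add: divide_simps) (simp add: algebra_simps)
    also have "\<dots> = 8 * H / (x + 2) + \<epsilon> * ((x * x + 3 * x) / ((x + 1) * (x + 2)))"
      using ne by (simp add: add_divide_distrib[of "8 * H * (x + 1)"])
    finally show ?thesis unfolding den .
  qed
  also have "\<dots> \<le> 8 * H / (x + 2) + \<epsilon> * 1"
  proof (intro add_left_mono mult_left_mono)
    have "0 \<le> x * x" by simp
    then have "0 < x * x + 3 * x + 2" using x by linarith
    then show "(x * x + 3 * x) / (x * x + 3 * x + 2) \<le> 1" by simp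
  qed (use assms in simp)
  finally show ?thesis unfolding diff by (simp add: x_def)
qed

lemma invariant_step:
  assumes inv: "(Q, h, T, N) \<in> invariant \<epsilon> \<alpha> k" and pos: "0 < \<epsilon>" "0 < \<alpha>"
    and Q': "Q' = (\<lambda>s a. \<beta>_seq k * T s a)" and d: "d = (\<lambda>s. max_act M Q' s - h s)"
    and m: "m = max (nat \<lceil>\<alpha> * c_seq k * (sp_state M d)\<^sup>2 / \<epsilon>\<^sup>2\<rceil>) 1"
    and D: "D \<in> set_pmf (sample M d m)"
    and err: "\<And>s a. s \<in> states M \<Longrightarrow> a \<in> actions M \<Longrightarrow>
      \<bar>sampling_error (max_act M Q') (\<lambda>s a. T s a + D s a) s a\<bar> \<le> \<epsilon>"
  shows "(Q', max_act M Q', (\<lambda>s a. T s a + D s a), N + card (states M) * card (actions M) * m)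
    \<in> invariant \<epsilon> \<alpha> (Suc k)"
proof -
  obtain T' where QT': "\<And>s a. s \<in> states M \<Longrightarrow> a \<in> actions M \<Longrightarrow> Q s a = \<beta>_seq (k - 1) * T' s a"
    and h: "\<And>s. s \<in> states M \<Longrightarrow> h s = max_act M Q s"
    and TT': "sp_mat M (\<lambda>s a. T s a - T' s a) \<le> 8 * H / (real k + 1) + \<epsilon>"
    and TQs: "sp_mat M (\<lambda>s a. T s a - Qs s a) \<le> H + 1 + \<epsilon> * (real k + 1)"
    and T': "sp_mat M T' \<le> 4 * H + \<epsilon> * real k"
    and N: "real N \<le> SA * (\<Sum>i<k. sample_bound \<epsilon> \<alpha> i)"
    using inv by (auto simp: invariant_def)
  have sp_d: "sp_state M d \<le> 8 * H / (real k + 2) + \<epsilon>"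
  proof -
    have "sp_state M d = sp_state M (\<lambda>s. max_act M Q' s - max_act M Q s)"
      unfolding d by (rule sp_state_cong) (simp add: h)
    also have "\<dots> \<le> sp_mat M (\<lambda>s a. Q' s a - Q s a)" by (rule sp_state_max_act_diff)
    \<comment> \<open>With anchor 0, Q' and Q are multiples of T and T'; the split separates the
      change of the matrix from the change of the weight.\<close>
    also have "\<dots> = sp_mat M (\<lambda>s a. \<beta>_seq k * (T s a - T' s a) + (\<beta>_seq k - \<beta>_seq (k - 1)) * T' s a)"
      by (rule sp_mat_cong) (simp add: Q' QT' algebra_simps)
    also have "\<dots> \<le> sp_mat M (\<lambda>s a. \<beta>_seq k * (T s a - T' s a))
        + sp_mat M (\<lambda>s a. (\<beta>_seq k - \<beta>_seq (k - 1)) * T' s a)"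
      by (rule sp_mat_add_le)
    also have "\<dots> \<le> \<beta>_seq k * sp_mat M (\<lambda>s a. T s a - T' s a)
        + (\<beta>_seq k - \<beta>_seq (k - 1)) * sp_mat M T'"
      by (intro add_mono sp_mat_mult) (use \<beta>_seq_bounds[of k] in simp_all)
    also have "\<dots> \<le> \<beta>_seq k * (8 * H / (real k + 1) + \<epsilon>)
        + (\<beta>_seq k - \<beta>_seq (k - 1)) * (4 * H + \<epsilon> * real k)"
      by (intro add_mono mult_left_mono TT' T') (use \<beta>_seq_bounds[of k] in simp_all)
    also have "\<dots> \<le> 8 * H / (real k + 2) + \<epsilon>" by (rule increment_arith[OF pos(1)])
    finally show ?thesis .
  qed
  have "1 \<le> m" by (simp add: m)
  have "sp_mat M (\<lambda>s a. (T s a + D s a) - T s a) \<le> 8 * H / (real (Suc k) + 1) + \<epsilon>"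
    using sp_sample_le[OF D \<open>1 \<le> m\<close>] sp_d by (simp add: add.commute)
  moreover have "sp_mat M (\<lambda>s a. (T s a + D s a) - Qs s a) \<le> H + 1 + \<epsilon> * (real (Suc k) + 1)"
  proof -
    let ?E = "sampling_error (max_act M Q') (\<lambda>s a. T s a + D s a)"
    have "sp_mat M (\<lambda>s a. (T s a + D s a) - Qs s a)
        = sp_mat M (\<lambda>s a. (bellman M Q' s a - bellman M Qs s a) + (?E s a + g))"
    proof (rule sp_mat_cong)
      fix s a assume "s \<in> states M" "a \<in> actions M"
      then show "T s a + D s a - Qs s a = bellman M Q' s a - bellman M Qs s a + (?E s a + g)"
        using bellman_Qs[of s a] bellman_sampling_error[of "max_act M Q'" Q' "\<lambda>s a. T s a + D s a" s a]
        by linarith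
    qed
    also have "\<dots> \<le> sp_mat M (\<lambda>s a. bellman M Q' s a - bellman M Qs s a) + sp_mat M (\<lambda>s a. ?E s a + g)"
      by (rule sp_mat_add_le)
    also have "\<dots> \<le> sp_mat M (\<lambda>s a. Q' s a - Qs s a) + 2 * \<epsilon>"
    proof (rule add_mono[OF sp_bellman_diff])
      show "sp_mat M (\<lambda>s a. ?E s a + g) \<le> 2 * \<epsilon>"
      proof (rule sp_mat_leI)
        fix s a t b assume "s \<in> states M" "a \<in> actions M" "t \<in> states M" "b \<in> actions M"
        then show "?E s a + g - (?E t b + g) \<le> 2 * \<epsilon>" using err[of s a] err[of t b] by linarith
      qed
    qed
    also have "sp_mat M (\<lambda>s a. Q' s a - Qs s a)
        = sp_mat M (\<lambda>s a. \<beta>_seq k * (T s a - Qs s a) - (1 - \<beta>_seq k) * Qs s a)"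
      by (rule sp_mat_cong) (simp add: Q' algebra_simps)
    also have "\<dots> \<le> sp_mat M (\<lambda>s a. \<beta>_seq k * (T s a - Qs s a)) + sp_mat M (\<lambda>s a. (1 - \<beta>_seq k) * Qs s a)"
      by (rule sp_mat_diff_le)
    also have "\<dots> \<le> \<beta>_seq k * sp_mat M (\<lambda>s a. T s a - Qs s a) + (1 - \<beta>_seq k) * sp_mat M Qs"
      by (intro add_mono sp_mat_mult) (use \<beta>_seq_bounds[of k] in simp_all)
    also have "\<dots> \<le> \<beta>_seq k * (H + 1 + \<epsilon> * (real k + 1)) + (1 - \<beta>_seq k) * (H + 1)"
      by (intro add_mono mult_left_mono TQs sp_Qs_le) (use \<beta>_seq_bounds[of k] in simp_all)
    also have "\<dots> = H + 1 + \<beta>_seq k * (\<epsilon> * (real k + 1))" by (simp add: algebra_simps)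
    \<comment> \<open>k (k + 1) / (k + 2) <= k: anchoring removes one \<epsilon> while the new error
      adds 2 \<epsilon>, so the distance to Q* grows by only one \<epsilon> per iteration.\<close>
    also have "\<beta>_seq k * (\<epsilon> * (real k + 1)) \<le> \<epsilon> * real k"
      using pos(1) by (simp add: \<beta>_seq_def field_simps)
    finally show ?thesis by (simp add: algebra_simps)
  qed
  \<comment> \<open>Two copies of H + 1 are at most 4 H because H >= 1.\<close>
  moreover have "sp_mat M T \<le> 4 * H + \<epsilon> * real (Suc k)"
  proof -
    have "sp_mat M T \<le> sp_mat M (\<lambda>s a. T s a - Qs s a) + sp_mat M Qs"
      using sp_mat_add_le[of "\<lambda>s a. T s a - Qs s a" Qs] by simp
    then show ?thesis using TQs sp_Qs_le H_ge_1 by (simp add: algebra_simps)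
  qed
  moreover have "real (N + card (states M) * card (actions M) * m) \<le> SA * (\<Sum>i<Suc k. sample_bound \<epsilon> \<alpha> i)"
  proof -
    have "(sp_state M d)\<^sup>2 \<le> (8 * H / (real k + 2) + \<epsilon>)\<^sup>2"
      using sp_d sp_state_nonneg by (rule power_mono)
    then have "\<alpha> * c_seq k * (sp_state M d)\<^sup>2 / \<epsilon>\<^sup>2 \<le> \<alpha> * c_seq k * (8 * H / (real k + 2) + \<epsilon>)\<^sup>2 / \<epsilon>\<^sup>2"
      using pos c_seq_pos[of k] by (intro divide_right_mono mult_left_mono) auto
    moreover have "0 \<le> \<alpha> * c_seq k * (sp_state M d)\<^sup>2 / \<epsilon>\<^sup>2"
      using pos c_seq_pos[of k] by simp
    ultimately have "real m \<le> sample_bound \<epsilon> \<alpha> k"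
      unfolding m sample_bound_def by linarith
    then have "SA * real m \<le> SA * sample_bound \<epsilon> \<alpha> k" using SA_ge_1 by (intro mult_left_mono) auto
    then show ?thesis using N by (simp add: SA_def algebra_simps)
  qed
  ultimately show ?thesis
    unfolding invariant_def using err by (auto simp: Q' intro!: exI[of _ T])
qed

text \<open>\<open>invariant_step\<close> is deterministic apart from its bound on the new sampling
  error, so each iteration costs one more concentration failure.\<close>

lemma savia_iter_invariant:
  assumes pos: "0 < \<epsilon>" "0 < \<alpha>"
  shows "measure_pmf.prob (savia_iter M c_seq \<beta>_seq (\<lambda>s a. 0) \<epsilon> \<alpha> k) (- invariant \<epsilon> \<alpha> k)
    \<le> real k * (2 * SA * exp (- \<alpha>))"
proof (induction k)
  case 0
  then show ?case using invariant_0[OF pos(1)] by simp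
next
  case (Suc k)
  let ?bad = "{(Q, h, T, N). \<exists>s\<in>states M. \<exists>a\<in>actions M. \<epsilon> < \<bar>sampling_error h T s a\<bar>}"
  have "measure_pmf.prob (savia_iter M c_seq \<beta>_seq (\<lambda>s a. 0) \<epsilon> \<alpha> (Suc k)) (- invariant \<epsilon> \<alpha> (Suc k))
    \<le> measure_pmf.prob (savia_iter M c_seq \<beta>_seq (\<lambda>s a. 0) \<epsilon> \<alpha> k) (- invariant \<epsilon> \<alpha> k)
      + measure_pmf.prob (savia_iter M c_seq \<beta>_seq (\<lambda>s a. 0) \<epsilon> \<alpha> (Suc k)) ?bad"
    unfolding savia_iter.simps(2)
  proof (rule measure_bind_pmf_le)
    fix x y :: "('s \<Rightarrow> 'a \<Rightarrow> real) \<times> ('s \<Rightarrow> real) \<times> ('s \<Rightarrow> 'a \<Rightarrow> real) \<times> nat"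
    obtain Q h T N where x: "x = (Q, h, T, N)" by (cases x) auto
    have \<beta>: "(if k = 0 then 0 else \<beta>_seq k) = \<beta>_seq k" by (simp add: \<beta>_seq_def)
    define Q' where "Q' = (\<lambda>s a. \<beta>_seq k * T s a)"
    define d where "d = (\<lambda>s. max_act M Q' s - h s)"
    define m where "m = max (nat \<lceil>\<alpha> * c_seq k * (sp_state M d)\<^sup>2 / \<epsilon>\<^sup>2\<rceil>) 1"
    assume "x \<notin> - invariant \<epsilon> \<alpha> k"
    then have inv: "(Q, h, T, N) \<in> invariant \<epsilon> \<alpha> k" using x by simp
    assume "y \<in> set_pmf (case x of (_, h', T', N) \<Rightarrow>
      let b = (if k = 0 then 0 else \<beta>_seq k); Q = (\<lambda>s a. (1 - b) * 0 + b * T' s a); h = max_act M Q;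
          d = (\<lambda>s. h s - h' s); m = max (nat \<lceil>\<alpha> * c_seq k * (sp_state M d)\<^sup>2 / \<epsilon>\<^sup>2\<rceil>) 1
      in map_pmf (\<lambda>D. (Q, h, (\<lambda>s a. T' s a + D s a), N + card (states M) * card (actions M) * m))
            (sample M d m))"
    then obtain D where D: "D \<in> set_pmf (sample M d m)" and
      y: "y = (Q', max_act M Q', (\<lambda>s a. T s a + D s a), N + card (states M) * card (actions M) * m)"
      unfolding x prod.case \<beta> Let_def mult_zero_right add_0 set_map_pmf m_def d_def Q'_def by blast
    assume "y \<in> - invariant \<epsilon> \<alpha> (Suc k)"
    then show "y \<in> ?bad"
      using invariant_step[OF inv pos Q'_def d_def m_def D] unfolding y by force
  qed
  also have "\<dots> \<le> real k * (2 * SA * exp (- \<alpha>)) + 2 * real (card (states M)) * real (card (actions M)) * exp (- \<alpha>)"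
    using sum_inverse_c_seq_le[of "Suc k"]
    by (intro add_mono Suc.IH savia_iter_concentration pos c_seq_pos) linarith
  also have "\<dots> = real (Suc k) * (2 * SA * exp (- \<alpha>))" by (simp add: SA_def algebra_simps)
  finally show ?case .
qed

text \<open>Q - T(Q) is the tested quantity Q - T plus the sampling error, whose span is at most 2
  \<epsilon>; passing the test at 14 \<epsilon> thus certifies 16 \<epsilon>.\<close>

lemma invariant_residual:
  assumes "(Q, h, T, N) \<in> invariant \<epsilon> \<alpha> (Suc n)" "0 < \<epsilon>"
  shows "sp_mat M (\<lambda>s a. Q s a - bellman M Q s a) \<le> sp_mat M (\<lambda>s a. Q s a - T s a) + 2 * \<epsilon>"
    and "2 * H / \<epsilon> \<le> real n \<Longrightarrow> sp_mat M (\<lambda>s a. Q s a - T s a) \<le> 14 * \<epsilon>"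
    and "real N \<le> SA * (\<Sum>i\<le>n. sample_bound \<epsilon> \<alpha> i)"
proof -
  obtain T' where T'_raw: "\<forall>s\<in>states M. \<forall>a\<in>actions M. Q s a = \<beta>_seq (Suc n - 1) * T' s a"
      "sp_mat M (\<lambda>s a. T s a - T' s a) \<le> 8 * H / (real (Suc n) + 1) + \<epsilon>"
      "sp_mat M T' \<le> 4 * H + \<epsilon> * real (Suc n)"
    and h: "\<forall>s\<in>states M. h s = max_act M Q s"
    and err: "\<forall>s\<in>states M. \<forall>a\<in>actions M. \<bar>sampling_error h T s a\<bar> \<le> \<epsilon>"
    and N: "real N \<le> SA * (\<Sum>i<Suc n. sample_bound \<epsilon> \<alpha> i)"
    using assms(1) unfolding invariant_def by blast
  have QT': "Q s a = \<beta>_seq n * T' s a" if "s \<in> states M" "a \<in> actions M" for s a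
    using T'_raw(1) that by simp
  have TT': "sp_mat M (\<lambda>s a. T s a - T' s a) \<le> 8 * H / (real n + 2) + \<epsilon>"
    using T'_raw(2) by (simp add: add.commute)
  have T': "sp_mat M T' \<le> 4 * H + \<epsilon> * (real n + 1)"
    using T'_raw(3) by (simp add: add.commute)
  show "real N \<le> SA * (\<Sum>i\<le>n. sample_bound \<epsilon> \<alpha> i)" using N by (simp only: lessThan_Suc_atMost)
  have "sp_mat M (\<lambda>s a. Q s a - bellman M Q s a)
      = sp_mat M (\<lambda>s a. (Q s a - T s a) + sampling_error h T s a)"
  proof (rule sp_mat_cong)
    fix s a
    show "Q s a - bellman M Q s a = Q s a - T s a + sampling_error h T s a"
      using bellman_sampling_error[of h Q T s a] h by simp
  qed
  also have "\<dots> \<le> sp_mat M (\<lambda>s a. Q s a - T s a) + sp_mat M (sampling_error h T)"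
    by (rule sp_mat_add_le)
  also have "sp_mat M (sampling_error h T) \<le> 2 * \<epsilon>" using err by (intro sp_mat_abs_le) blast
  finally show "sp_mat M (\<lambda>s a. Q s a - bellman M Q s a) \<le> sp_mat M (\<lambda>s a. Q s a - T s a) + 2 * \<epsilon>"
    by simp
  assume n: "2 * H / \<epsilon> \<le> real n"
  have "sp_mat M (\<lambda>s a. Q s a - T s a) = sp_mat M (\<lambda>s a. - ((1 - \<beta>_seq n) * T' s a) - (T s a - T' s a))"
    by (rule sp_mat_cong) (simp add: QT' algebra_simps)
  also have "\<dots> \<le> sp_mat M (\<lambda>s a. - ((1 - \<beta>_seq n) * T' s a)) + sp_mat M (\<lambda>s a. T s a - T' s a)"
    by (rule sp_mat_diff_le)
  also have "\<dots> \<le> (1 - \<beta>_seq n) * (4 * H + \<epsilon> * (real n + 1)) + (8 * H / (real n + 2) + \<epsilon>)"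
  proof (rule add_mono[OF _ TT'])
    have "sp_mat M (\<lambda>s a. - ((1 - \<beta>_seq n) * T' s a)) \<le> (1 - \<beta>_seq n) * sp_mat M T'"
      using sp_mat_uminus sp_mat_mult[of "1 - \<beta>_seq n" T'] \<beta>_seq_bounds(2)[of n] order_trans by fastforce
    also have "\<dots> \<le> (1 - \<beta>_seq n) * (4 * H + \<epsilon> * (real n + 1))"
      using T' \<beta>_seq_bounds(2)[of n] by (intro mult_left_mono) auto
    finally show "sp_mat M (\<lambda>s a. - ((1 - \<beta>_seq n) * T' s a)) \<le> (1 - \<beta>_seq n) * (4 * H + \<epsilon> * (real n + 1))" .
  qed
  \<comment> \<open>Here 1 - \<beta>_n = 2 / (n + 2). Since 16 H <= 8 \<epsilon> n, the numerator is
    at most \<epsilon> (11 n + 4), well below 14 \<epsilon> (n + 2).\<close>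
  also have "\<dots> = (16 * H + \<epsilon> * (3 * real n + 4)) / (real n + 2)"
    by (simp add: \<beta>_seq_def divide_simps) (simp add: algebra_simps)
  also have "\<dots> \<le> 14 * \<epsilon>"
  proof -
    have "2 * H \<le> \<epsilon> * real n" using n assms(2) by (simp add: pos_divide_le_eq mult.commute)
    moreover have "0 \<le> \<epsilon> * real n" using assms(2) by simp
    moreover have "14 * \<epsilon> * (real n + 2) - (16 * H + \<epsilon> * (3 * real n + 4)) = 11 * (\<epsilon> * real n) - 16 * H + 24 * \<epsilon>"
      by (simp add: algebra_simps)
    ultimately have "16 * H + \<epsilon> * (3 * real n + 4) \<le> 14 * \<epsilon> * (real n + 2)"
      using assms(2) by linarith
    then show ?thesis by (simp add: pos_divide_le_eq)
  qed
  finally show "sp_mat M (\<lambda>s a. Q s a - T s a) \<le> 14 * \<epsilon>" .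
qed

text \<open>The residual estimate is not tied to n >= 2 H / \<epsilon>: the loop may stop earlier,
  and its output must still be accurate.\<close>

definition good_run ::
  "(('s \<Rightarrow> 'a \<Rightarrow> real) \<Rightarrow> 's \<Rightarrow> 'a) \<Rightarrow> real \<Rightarrow> real \<Rightarrow> nat \<Rightarrow>
   (('s \<Rightarrow> 'a \<Rightarrow> real) \<times> ('s \<Rightarrow> 'a \<Rightarrow> real) \<times> ('s \<Rightarrow> 'a) \<times> nat) set" where
  "good_run pick \<epsilon> \<alpha> n = {(Q, T, \<pi>, N). \<pi> = pick Q \<and>
     sp_mat M (\<lambda>s a. Q s a - bellman M Q s a) \<le> sp_mat M (\<lambda>s a. Q s a - T s a) + 2 * \<epsilon> \<and>
     (2 * H / \<epsilon> \<le> real n \<longrightarrow> sp_mat M (\<lambda>s a. Q s a - T s a) \<le> 14 * \<epsilon>) \<and>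
     real N \<le> SA * (\<Sum>i\<le>n. sample_bound \<epsilon> \<alpha> i)}"

text \<open>\<alpha> is chosen so that n + 1 iterations, each failing with probability at most 2 |S|
  |A| exp (-\<alpha>), use up exactly \<delta>.\<close>

lemma savia_good_run:
  assumes \<epsilon>: "0 < \<epsilon>" and \<delta>: "0 < \<delta>" "\<delta> \<le> 1"
    and \<alpha>: "\<alpha> = ln (2 * SA * (real n + 1) / \<delta>)"
  shows "measure_pmf.prob (savia M c_seq \<beta>_seq pick (\<lambda>s a. 0) n \<epsilon> \<delta>) (- good_run pick \<epsilon> \<alpha> n) \<le> \<delta>"
proof -
  have "1 < 2 * SA * (real n + 1) / \<delta>"
  proof -
    have "1 * 1 \<le> SA * (real n + 1)" using SA_ge_1 by (intro mult_mono) auto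
    then show ?thesis using \<delta> by (simp add: pos_less_divide_eq)
  qed
  then have \<alpha>_pos: "0 < \<alpha>" and exp_\<alpha>: "exp (- \<alpha>) = \<delta> / (2 * SA * (real n + 1))"
    unfolding \<alpha> by (simp_all add: exp_minus)
  let ?f = "\<lambda>(Q, h :: 's \<Rightarrow> real, T :: 's \<Rightarrow> 'a \<Rightarrow> real, N :: nat). (Q, T, pick Q, N)"
  let ?p = "savia_iter M c_seq \<beta>_seq (\<lambda>s a. 0) \<epsilon> \<alpha> (n + 1)"
  have "measure_pmf.prob (savia M c_seq \<beta>_seq pick (\<lambda>s a. 0) n \<epsilon> \<delta>) (- good_run pick \<epsilon> \<alpha> n)
      = measure_pmf.prob ?p (?f -` (- good_run pick \<epsilon> \<alpha> n))"
    by (simp add: savia_def \<alpha> SA_def Let_def mult.assoc del: savia_iter.simps)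
  also have "\<dots> \<le> measure_pmf.prob ?p (- invariant \<epsilon> \<alpha> (n + 1))"
  proof (rule measure_pmf.finite_measure_mono)
    show "?f -` (- good_run pick \<epsilon> \<alpha> n) \<subseteq> - invariant \<epsilon> \<alpha> (n + 1)"
      using invariant_residual[of _ _ _ _ \<epsilon> \<alpha> n, OF _ \<epsilon>] by (fastforce simp: good_run_def)
  qed simp
  also have "\<dots> \<le> real (n + 1) * (2 * SA * exp (- \<alpha>))"
    by (rule savia_iter_invariant[OF \<epsilon> \<alpha>_pos])
  also have "\<dots> = 2 * SA * (real n + 1) * exp (- \<alpha>)" by (simp add: algebra_simps)
  also have "\<dots> = \<delta>"
  proof -
    have "2 * SA * (real n + 1) \<noteq> 0" using SA_ge_1 by simp
    then show ?thesis unfolding exp_\<alpha> by (rule nonzero_mult_div_cancel_left[THEN trans[OF times_divide_eq_right]])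
  qed
  finally show ?thesis .
qed

end


section \<open>Sample complexity\<close>

lemma one_le_c_seq: "1 \<le> c_seq k"
proof -
  have "2 / 3 \<le> ln (real k + 2)"
    using ln2_ge_two_thirds ln_le_cancel_iff[of 2 "real k + 2"] by linarith
  then have "(2 / 3)\<^sup>2 \<le> (ln (real k + 2))\<^sup>2" by (intro power_mono) auto
  then have "5 * 2 * (2 / 3)\<^sup>2 \<le> 5 * (real k + 2) * (ln (real k + 2))\<^sup>2"
    by (intro mult_mono) auto
  then show ?thesis by (simp add: c_seq_def power2_eq_square)
qed

text \<open>A crude polynomial bound suffices, since it enters only inside the logarithm of
  \<open>loop_alpha_le\<close>.\<close>

lemma c_seq_le: "c_seq k \<le> 5 * (real k + 2) ^ 3"
proof -
  have "(ln (real k + 2))\<^sup>2 \<le> (real k + 2)\<^sup>2"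
    using ln_le_minus_one[of "real k + 2"] by (intro power_mono) auto
  then have "5 * (real k + 2) * (ln (real k + 2))\<^sup>2 \<le> 5 * (real k + 2) * (real k + 2)\<^sup>2"
    by (intro mult_left_mono) auto
  then show ?thesis by (simp only: c_seq_def power2_eq_square power3_eq_cube mult.assoc)
qed

lemma sum_inverse_le_ln: "(\<Sum>k\<le>n. 1 / (real k + 2)) \<le> ln (real n + 2)"
proof (induction n)
  case 0
  then show ?case using ln2_ge_two_thirds by simp
next
  case (Suc n)
  have "ln (real n + 2) - ln (real n + 3) \<le> (real n + 2 - (real n + 3)) / (real n + 3)"
    by (rule ln_diff_le) auto
  then show ?case using Suc.IH by (simp add: add.commute)
qed

context savia_context
begin

text \<open>With a single state the span H would be 0. The factor 2 keeps the logarithm in the rate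
  away from 0, so that it can absorb constants.\<close>

lemma SA_ge_2: "2 \<le> SA"
proof -
  have "card (states M) \<noteq> 1"
  proof
    assume "card (states M) = 1"
    then obtain s where "states M = {s}" by (auto simp: card_1_singleton_iff)
    then have "H = 0" by (simp add: H_def sp_state_def sp_norm_def)
    then show False using H_ge_1 by simp
  qed
  moreover have "1 \<le> card (states M)" "1 \<le> card (actions M)"
    using finite_states states_nonempty finite_actions actions_nonempty
    by (auto simp: Suc_le_eq card_gt_0_iff)
  ultimately have "2 * 1 \<le> card (states M) * card (actions M)" by (intro mult_le_mono) auto
  then have "real 2 \<le> real (card (states M) * card (actions M))" by (simp only: of_nat_le_iff)
  then show ?thesis by (simp add: SA_def)
qed

text \<open>Split the square by (a + b)^2 <= 2 (a^2 + b^2). The H part leaves a harmonic sum, hence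
  a third logarithm beside the two in c_k; the \<epsilon> part grows like \<epsilon>^2 n^2, which
  the second bound on n turns into H^2. The constant is 1600 = 10 * (64 + 96).\<close>

lemma sum_sample_bound_le:
  assumes \<epsilon>: "0 < \<epsilon>" and \<alpha>: "0 \<le> \<alpha>" and n: "1 \<le> n" "\<epsilon> * real n \<le> 4 * H"
  shows "(\<Sum>k\<le>n. sample_bound \<epsilon> \<alpha> k) \<le> 2 * real n + 1600 * \<alpha> * H\<^sup>2 * ln (real n + 2) ^ 3 / \<epsilon>\<^sup>2"
proof -
  define l where "l = ln (real n + 2)"
  have l: "1 \<le> l"
    unfolding l_def using n(1) exp_le by (subst ln_ge_iff) auto
  have term_le: "c_seq k * (8 * H / (real k + 2) + \<epsilon>)\<^sup>2
      \<le> 10 * l\<^sup>2 * (64 * H\<^sup>2 * (1 / (real k + 2)) + \<epsilon>\<^sup>2 * (real n + 2))" if "k \<le> n" for k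
  proof -
    define y where "y = real k + 2"
    have y: "2 \<le> y" "y \<le> real n + 2" using that by (auto simp: y_def)
    have sq: "(8 * H / y + \<epsilon>)\<^sup>2 \<le> 2 * (64 * H\<^sup>2 / y\<^sup>2 + \<epsilon>\<^sup>2)"
      using sum_squares_bound[of "8 * H / y" \<epsilon>] by (simp add: power2_sum power_divide power_mult_distrib)
    have lny: "(ln y)\<^sup>2 \<le> l\<^sup>2" unfolding l_def using y by (intro power_mono) auto
    have "c_seq k * (8 * H / y + \<epsilon>)\<^sup>2 \<le> (5 * y * (ln y)\<^sup>2) * (2 * (64 * H\<^sup>2 / y\<^sup>2 + \<epsilon>\<^sup>2))"
      unfolding c_seq_def y_def[symmetric] using sq y by (intro mult_left_mono) auto
    also have "\<dots> = 10 * (ln y)\<^sup>2 * (64 * H\<^sup>2 * (1 / y) + \<epsilon>\<^sup>2 * y)"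
      using y by (simp add: field_simps power2_eq_square)
    also have "\<dots> \<le> 10 * l\<^sup>2 * (64 * H\<^sup>2 * (1 / y) + \<epsilon>\<^sup>2 * (real n + 2))"
      using y lny by (intro mult_mono add_left_mono mult_left_mono) auto
    finally show ?thesis by (simp only: y_def)
  qed
  have "(\<Sum>k\<le>n. c_seq k * (8 * H / (real k + 2) + \<epsilon>)\<^sup>2)
      \<le> (\<Sum>k\<le>n. 10 * l\<^sup>2 * (64 * H\<^sup>2 * (1 / (real k + 2)) + \<epsilon>\<^sup>2 * (real n + 2)))"
    by (rule sum_mono) (use term_le in simp)
  also have "\<dots> = 10 * l\<^sup>2 * (64 * H\<^sup>2 * (\<Sum>k\<le>n. 1 / (real k + 2)) + \<epsilon>\<^sup>2 * ((real n + 1) * (real n + 2)))"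
    by (simp only: sum_distrib_left[symmetric] sum.distrib sum_constant) (simp add: algebra_simps)
  also have "\<dots> \<le> 10 * l\<^sup>2 * (64 * H\<^sup>2 * l + 96 * H\<^sup>2 * l)"
  proof (intro mult_left_mono add_mono)
    show "(\<Sum>k\<le>n. 1 / (real k + 2)) \<le> l" unfolding l_def by (rule sum_inverse_le_ln)
    have "(real n + 1) * (real n + 2) \<le> (2 * real n) * (3 * real n)" using n(1) by (intro mult_mono) auto
    then have "\<epsilon>\<^sup>2 * ((real n + 1) * (real n + 2)) \<le> \<epsilon>\<^sup>2 * ((2 * real n) * (3 * real n))"
      by (rule mult_left_mono) simp
    also have "\<dots> = 6 * (\<epsilon> * real n)\<^sup>2" by (simp add: power2_eq_square)
    also have "\<dots> \<le> 6 * (4 * H)\<^sup>2" using n(2) \<epsilon> by (intro mult_left_mono power_mono) auto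
    also have "\<dots> = 96 * H\<^sup>2 * 1" by (simp add: power2_eq_square)
    also have "\<dots> \<le> 96 * H\<^sup>2 * l" using l by (intro mult_left_mono) auto
    finally show "\<epsilon>\<^sup>2 * ((real n + 1) * (real n + 2)) \<le> 96 * H\<^sup>2 * l" .
  qed auto
  also have "\<dots> = 1600 * H\<^sup>2 * l ^ 3" by (simp add: power2_eq_square power3_eq_cube algebra_simps)
  finally have main: "(\<Sum>k\<le>n. c_seq k * (8 * H / (real k + 2) + \<epsilon>)\<^sup>2) \<le> 1600 * H\<^sup>2 * l ^ 3" .
  have "(\<Sum>k\<le>n. sample_bound \<epsilon> \<alpha> k)
      = (real n + 1) + \<alpha> / \<epsilon>\<^sup>2 * (\<Sum>k\<le>n. c_seq k * (8 * H / (real k + 2) + \<epsilon>)\<^sup>2)"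
    by (simp add: sample_bound_def sum.distrib sum_distrib_left mult_ac)
  also have "\<dots> \<le> 2 * real n + \<alpha> / \<epsilon>\<^sup>2 * (1600 * H\<^sup>2 * l ^ 3)"
    using n(1) \<alpha> main by (intro add_mono mult_left_mono) auto
  finally show ?thesis by (simp add: l_def mult_ac)
qed

section \<open>Logarithmic factors and the number of loops\<close>

definition loop_alpha :: "real \<Rightarrow> nat \<Rightarrow> real" where
  "loop_alpha \<delta> i = ln (2 * SA * (real (2 ^ i) + 1) / (\<delta> / c_seq i))"

definition log_factor :: "real \<Rightarrow> real" where
  "log_factor \<epsilon> = max 1 (ln (H / \<epsilon>))"

definition log_rate :: "real \<Rightarrow> real \<Rightarrow> real" where
  "log_rate \<epsilon> \<delta> = ln (SA * H / (\<epsilon> * \<delta>))"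

lemma rate_argument_ge_2:
  assumes "0 < \<epsilon>" "\<epsilon> \<le> 1" "0 < \<delta>" "\<delta> < 1"
  shows "2 \<le> SA * H / (\<epsilon> * \<delta>)" "1 \<le> H / \<epsilon>"
proof -
  have "2 * 1 \<le> SA * H" using SA_ge_2 H_ge_1 by (intro mult_mono) auto
  moreover have "\<epsilon> * \<delta> \<le> 1 * 1" using assms by (intro mult_mono) auto
  ultimately show "2 \<le> SA * H / (\<epsilon> * \<delta>)" using assms by (simp add: le_divide_eq)
  show "1 \<le> H / \<epsilon>" using assms H_ge_1 by (simp add: le_divide_eq)
qed

lemma log_rate_ge: "0 < \<epsilon> \<Longrightarrow> \<epsilon> \<le> 1 \<Longrightarrow> 0 < \<delta> \<Longrightarrow> \<delta> < 1 \<Longrightarrow> 1 / 2 \<le> log_rate \<epsilon> \<delta>"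
  using rate_argument_ge_2(1)[of \<epsilon> \<delta>] ln2_ge_two_thirds
    ln_le_cancel_iff[of 2 "SA * H / (\<epsilon> * \<delta>)"] unfolding log_rate_def by linarith

lemma loop_alpha_argument_ge_1:
  assumes \<delta>: "0 < \<delta>" "\<delta> < 1"
  shows "1 \<le> 2 * SA * (real (2 ^ i) + 1) / (\<delta> / c_seq i)"
proof -
  have "1 * 1 \<le> (SA * (real (2 ^ i) + 1)) * c_seq i"
  proof (intro mult_mono)
    have "1 * 1 \<le> SA * (real (2 ^ i) + 1)" using SA_ge_1 by (intro mult_mono) auto
    then show "1 \<le> SA * (real (2 ^ i) + 1)" "0 \<le> SA * (real (2 ^ i) + 1)" by auto
  qed (use one_le_c_seq in auto)
  then have "\<delta> \<le> 2 * (SA * (real (2 ^ i) + 1) * c_seq i)" using \<delta> by linarith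
  then show ?thesis using \<delta> by (simp add: le_divide_eq mult.assoc)
qed

lemma loop_alpha_nonneg: "0 < \<delta> \<Longrightarrow> \<delta> < 1 \<Longrightarrow> 0 \<le> loop_alpha \<delta> i"
  unfolding loop_alpha_def using loop_alpha_argument_ge_1 by simp

text \<open>
  With \<open>z = |S||A|H / (\<epsilon>\<delta>) \<ge> 2\<close>, the argument of the logarithm is at most
  \<open>160 (64 z)\<^sup>4 \<le> 2\<^sup>3\<^sup>2 z\<^sup>4 \<le> z\<^sup>3\<^sup>6\<close>.
\<close>

lemma loop_alpha_le:
  assumes \<epsilon>: "0 < \<epsilon>" "\<epsilon> \<le> 1" and \<delta>: "0 < \<delta>" "\<delta> < 1" and i: "2 ^ i \<le> 64 * (H / \<epsilon>)"
  shows "loop_alpha \<delta> i \<le> 36 * log_rate \<epsilon> \<delta>"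
proof -
  define x where "x = (2 :: real) ^ i"
  define y where "y = H / \<epsilon>"
  define z where "z = SA * H / (\<epsilon> * \<delta>)"
  have x: "1 \<le> x" by (simp add: x_def)
  have y: "1 \<le> y" and z: "2 \<le> z" using rate_argument_ge_2[OF \<epsilon> \<delta>] by (auto simp: y_def z_def)
  have z_eq: "z = y * (SA / \<delta>)" by (simp add: y_def z_def)
  have SA\<delta>: "1 \<le> SA / \<delta>" using SA_ge_1 \<delta> by (simp add: le_divide_eq)
  let ?A = "2 * SA * (x + 1) * c_seq i / \<delta>"
  have loop: "loop_alpha \<delta> i = ln ?A" by (simp add: loop_alpha_def x_def)
  have "real i + 2 \<le> 2 * x"
  proof -
    have "i + 2 \<le> 2 * 2 ^ i" by (induction i) auto
    then have "real (i + 2) \<le> real (2 * 2 ^ i)" by (simp only: of_nat_le_iff)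
    then show ?thesis by (simp add: x_def)
  qed
  then have "(real i + 2) ^ 3 \<le> (2 * x) ^ 3" by (intro power_mono) auto
  then have c: "c_seq i \<le> 40 * x ^ 3" using c_seq_le[of i] by (simp add: power_mult_distrib)
  have A1: "1 \<le> ?A" using loop_alpha_argument_ge_1[OF \<delta>] by (simp add: x_def)
  have "?A = 2 * (SA / \<delta>) * ((x + 1) * c_seq i)" by simp
  also have "\<dots> \<le> 2 * (SA / \<delta>) * ((2 * x) * (40 * x ^ 3))"
    using SA\<delta> x c c_seq_pos[of i] by (intro mult_left_mono mult_mono) auto
  also have "\<dots> = 160 * (SA / \<delta>) * x ^ 4" by (simp add: power3_eq_cube power4_eq_xxxx)
  also have "\<dots> \<le> 160 * (SA / \<delta>) * (64 * y) ^ 4"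
    using SA\<delta> i x by (intro mult_left_mono power_mono) (auto simp: x_def y_def)
  also have "\<dots> \<le> 160 * (SA / \<delta>) ^ 4 * (64 * y) ^ 4"
    using SA\<delta> y power_increasing[of 1 4 "SA / \<delta>"] by (intro mult_right_mono mult_left_mono) auto
  also have "\<dots> = 2684354560 * z ^ 4" by (simp only: z_eq power_mult_distrib) simp
  also have "\<dots> \<le> 2 ^ 32 * z ^ 4" using z by (intro mult_right_mono) auto
  also have "\<dots> \<le> z ^ 32 * z ^ 4" using z by (intro mult_right_mono power_mono) auto
  also have "\<dots> = z ^ 36" by (simp flip: power_add)
  finally have "ln ?A \<le> ln (z ^ 36)" using A1 by (intro ln_mono) auto
  also have "\<dots> = 36 * ln z" using z by (subst ln_realpow) auto
  finally show "loop_alpha \<delta> i \<le> 36 * log_rate \<epsilon> \<delta>" unfolding loop log_rate_def z_def .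
qed

lemma loop_samples_le:
  assumes \<epsilon>: "0 < \<epsilon>" "\<epsilon> \<le> 1" and \<delta>: "0 < \<delta>" "\<delta> < 1" and i: "2 ^ i \<le> 64 * (H / \<epsilon>)"
  shows "(\<Sum>k\<le>2 ^ i. sample_bound (\<epsilon> / 16) (loop_alpha \<delta> i) k)
    \<le> 11 * 10 ^ 9 * (log_rate \<epsilon> \<delta> * log_factor \<epsilon> ^ 3 * (H / \<epsilon>)\<^sup>2)"
proof -
  define x where "x = (2 :: real) ^ i"
  define y where "y = H / \<epsilon>"
  define L where "L = log_rate \<epsilon> \<delta>"
  define \<Lambda> where "\<Lambda> = log_factor \<epsilon>"
  define \<alpha> where "\<alpha> = loop_alpha \<delta> i"
  have y: "1 \<le> y" using rate_argument_ge_2[OF \<epsilon> \<delta>] by (simp add: y_def)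
  have x: "1 \<le> x" "x \<le> 64 * y" using i by (auto simp: x_def y_def)
  have L: "1 / 2 \<le> L" unfolding L_def by (rule log_rate_ge[OF \<epsilon> \<delta>])
  have \<Lambda>: "1 \<le> \<Lambda>" "ln y \<le> \<Lambda>" by (auto simp: \<Lambda>_def log_factor_def y_def)
  have \<alpha>: "0 \<le> \<alpha>" "\<alpha> \<le> 36 * L" unfolding \<alpha>_def L_def by (rule loop_alpha_nonneg[OF \<delta>] loop_alpha_le[OF \<epsilon> \<delta> i])+
  have "\<epsilon> / 16 * real (2 ^ i) \<le> 4 * H"
    using i \<epsilon> by (simp add: field_simps)
  then have "(\<Sum>k\<le>2 ^ i. sample_bound (\<epsilon> / 16) \<alpha> k)
      \<le> 2 * real (2 ^ i) + 1600 * \<alpha> * H\<^sup>2 * ln (real (2 ^ i) + 2) ^ 3 / (\<epsilon> / 16)\<^sup>2"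
    using \<epsilon> \<alpha> by (intro sum_sample_bound_le) auto
  also have "\<dots> = 2 * x + 409600 * \<alpha> * y\<^sup>2 * ln (x + 2) ^ 3"
    by (simp add: x_def y_def power_divide)
  \<comment> \<open>2 x <= 128 y, and L >= 1 / 2 doubles this to 256. In the second term x + 2 <=
    2^8 y gives ln (x + 2) <= 8 ln 2 + ln y <= 9 \<Lambda>.\<close>
  also have "\<dots> \<le> 256 * (L * \<Lambda> ^ 3 * y\<^sup>2) + 409600 * (36 * L) * y\<^sup>2 * (9 * \<Lambda>) ^ 3"
  proof (rule add_mono)
    have "1 * 1 \<le> 2 * L * \<Lambda> ^ 3" using L \<Lambda> by (intro mult_mono) auto
    moreover have "y * 1 \<le> y * y" using y by (intro mult_left_mono) auto
    ultimately have "1 * y \<le> (2 * L * \<Lambda> ^ 3) * (y * y)" using y by (intro mult_mono) auto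
    moreover have "(2 * L * \<Lambda> ^ 3) * (y * y) = 2 * (L * \<Lambda> ^ 3 * y\<^sup>2)" by (simp add: power2_eq_square)
    ultimately show "2 * x \<le> 256 * (L * \<Lambda> ^ 3 * y\<^sup>2)" using x(2) by linarith
    have "ln (x + 2) \<le> ln (2 ^ 8 * y)" using x by (subst ln_le_cancel_iff) auto
    also have "\<dots> = 8 * ln 2 + ln y" using y by (simp only: ln_mult ln_realpow) (simp add: ln_mult ln_realpow)
    also have "\<dots> \<le> 9 * \<Lambda>" using \<Lambda> ln_2_less_1 by linarith
    finally have "ln (x + 2) \<le> 9 * \<Lambda>" .
    then show "409600 * \<alpha> * y\<^sup>2 * ln (x + 2) ^ 3 \<le> 409600 * (36 * L) * y\<^sup>2 * (9 * \<Lambda>) ^ 3"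
      using \<alpha> L x by (intro mult_mono power_mono) auto
  qed
  also have "\<dots> = (256 + 409600 * 36 * 729) * (L * \<Lambda> ^ 3 * y\<^sup>2)"
    by (simp add: power_mult_distrib algebra_simps)
  also have "\<dots> \<le> 11 * 10 ^ 9 * (L * \<Lambda> ^ 3 * y\<^sup>2)"
    using L \<Lambda> by (intro mult_right_mono) auto
  finally show ?thesis by (simp add: \<alpha>_def L_def \<Lambda>_def y_def)
qed

text \<open>I is the first doubling that reaches 32 H / \<epsilon>, so it overshoots by at most a
  factor 2. It serves the analysis only: the algorithm does not know H.\<close>

lemma stopping_index:
  assumes \<epsilon>: "0 < \<epsilon>" "\<epsilon> \<le> 1"
  obtains I :: nat where "2 * H / (\<epsilon> / 16) \<le> 2 ^ I" "2 ^ I \<le> 64 * (H / \<epsilon>)"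
    and "real (Suc I) \<le> 9 * log_factor \<epsilon>"
proof -
  define y where "y = H / \<epsilon>"
  have y: "1 \<le> y" using \<epsilon> H_ge_1 by (simp add: y_def le_divide_eq)
  define I where "I = (LEAST i. 32 * y \<le> 2 ^ i)"
  have "\<exists>i. 32 * y \<le> 2 ^ i" using real_arch_pow[of 2 "32 * y"] by (auto intro: less_imp_le)
  then have ge: "32 * y \<le> 2 ^ I" unfolding I_def by (rule LeastI_ex)
  have le: "2 ^ I \<le> 64 * y"
  proof (cases I)
    case 0
    then show ?thesis using y by simp
  next
    case (Suc j)
    then have "\<not> 32 * y \<le> 2 ^ j" unfolding I_def by (metis lessI not_less_Least)
    then show ?thesis using Suc by simp
  qed
  have "real I * ln 2 = ln (2 ^ I)" by (simp add: ln_realpow)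
  also have "\<dots> \<le> ln (2 ^ 6 * y)" using le y by (subst ln_le_cancel_iff) auto
  also have "\<dots> = 6 * ln 2 + ln y" using y by (simp only: ln_mult ln_realpow) (simp add: ln_mult ln_realpow)
  finally have *: "(real I - 6) * ln 2 \<le> log_factor \<epsilon>"
    by (simp add: algebra_simps log_factor_def y_def)
  have "1 \<le> log_factor \<epsilon>" by (simp add: log_factor_def)
  moreover have "(real I - 6) * (2 / 3) \<le> log_factor \<epsilon>"
  proof (cases "real I \<le> 6")
    case True
    then have "(real I - 6) * (2 / 3) \<le> 0" by (intro mult_nonpos_nonneg) auto
    then show ?thesis using \<open>1 \<le> log_factor \<epsilon>\<close> by linarith
  next
    case False
    then have "(real I - 6) * (2 / 3) \<le> (real I - 6) * ln 2"
      using ln2_ge_two_thirds by (intro mult_left_mono) auto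
    then show ?thesis using * by linarith
  qed
  ultimately have "real (Suc I) \<le> 9 * log_factor \<epsilon>" by simp
  then show ?thesis using that[of I] ge le by (simp add: y_def)
qed

section \<open>The outer loop\<close>

definition good_output ::
  "(('s \<Rightarrow> 'a \<Rightarrow> real) \<Rightarrow> 's \<Rightarrow> 'a) \<Rightarrow> real \<Rightarrow> real \<Rightarrow>
   (('s \<Rightarrow> 'a \<Rightarrow> real) \<times> ('s \<Rightarrow> 'a \<Rightarrow> real) \<times> ('s \<Rightarrow> 'a) \<times> nat) set" where
  "good_output pick \<epsilon> B = {(Q, T, \<pi>, N).
     \<pi> = pick Q \<and> sp_mat M (\<lambda>s a. Q s a - bellman M Q s a) \<le> 16 * \<epsilon> \<and> real N \<le> B}"

definition loop_bound :: "real \<Rightarrow> real \<Rightarrow> nat \<Rightarrow> real" where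
  "loop_bound \<epsilon> \<delta> i = SA * (\<Sum>k\<le>2 ^ i. sample_bound \<epsilon> (loop_alpha \<delta> i) k)"

lemma loop_bound_nonneg:
  assumes "0 < \<delta>" "\<delta> < 1"
  shows "0 \<le> loop_bound \<epsilon> \<delta> i"
proof -
  have "0 \<le> sample_bound \<epsilon> (loop_alpha \<delta> i) k" for k
    unfolding sample_bound_def using loop_alpha_nonneg[OF assms] c_seq_pos[of k]
    by (intro add_nonneg_nonneg divide_nonneg_nonneg mult_nonneg_nonneg) auto
  then show ?thesis unfolding loop_bound_def using SA_ge_1 by (intro mult_nonneg_nonneg sum_nonneg) auto
qed

text \<open>Induction on I - i. A good run at index I passes the test, so the recursion never has to
  be followed further. Nontermination is \<open>None\<close>, which the complement of the
  \<open>Some\<close> image counts as failure.\<close>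

lemma savia_plus_loop_failure:
  assumes \<epsilon>: "0 < \<epsilon>" and \<delta>: "0 < \<delta>" "\<delta> < 1" and I: "2 * H / \<epsilon> \<le> 2 ^ I"
  shows "i \<le> I \<Longrightarrow> measure_pmf.prob (savia_plus_loop M c_seq \<beta>_seq pick (\<lambda>s a. 0) \<epsilon> \<delta> i N)
      (- Some ` good_output pick \<epsilon> (real N + (\<Sum>j=i..I. loop_bound \<epsilon> \<delta> j)))
    \<le> (\<Sum>j=i..I. \<delta> / c_seq j)"
proof (induction "I - i" arbitrary: i N rule: less_induct)
  case less
  let ?loop = "savia_plus_loop M c_seq \<beta>_seq pick (\<lambda>s a. 0) \<epsilon> \<delta>"
  define R where "R = (\<Sum>j=Suc i..I. loop_bound \<epsilon> \<delta> j)"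
  define F where "F = (\<Sum>j=Suc i..I. \<delta> / c_seq j)"
  have R: "0 \<le> R" unfolding R_def by (intro sum_nonneg loop_bound_nonneg \<delta>)
  have F: "0 \<le> F" unfolding F_def using \<delta> c_seq_pos by (intro sum_nonneg divide_nonneg_pos) auto
  let ?fail = "- Some ` good_output pick \<epsilon> (real N + (loop_bound \<epsilon> \<delta> i + R))"
  have \<delta>i: "0 < \<delta> / c_seq i" "\<delta> / c_seq i \<le> 1"
    using \<delta> one_le_c_seq[of i] by (auto simp: divide_le_eq)
  have "measure_pmf.prob (?loop i N) ?fail
    \<le> measure_pmf.prob (savia M c_seq \<beta>_seq pick (\<lambda>s a. 0) (2 ^ i) \<epsilon> (\<delta> / c_seq i))
        (- good_run pick \<epsilon> (loop_alpha \<delta> i) (2 ^ i)) + F"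
    unfolding savia_plus_loop.simps[of M c_seq \<beta>_seq pick "\<lambda>s a. 0" \<epsilon> \<delta> i N] bind_spmf_of_pmf
  proof (rule measure_bind_pmf_le_const[OF _ F])
    fix x :: "('s \<Rightarrow> 'a \<Rightarrow> real) \<times> ('s \<Rightarrow> 'a \<Rightarrow> real) \<times> ('s \<Rightarrow> 'a) \<times> nat"
    assume x_good: "x \<notin> - good_run pick \<epsilon> (loop_alpha \<delta> i) (2 ^ i)"
    obtain Q T \<pi> m where x: "x = (Q, T, \<pi>, m)" by (cases x) auto
    from x_good have \<pi>: "\<pi> = pick Q"
      and res: "sp_mat M (\<lambda>s a. Q s a - bellman M Q s a) \<le> sp_mat M (\<lambda>s a. Q s a - T s a) + 2 * \<epsilon>"
      and stop: "2 * H / \<epsilon> \<le> 2 ^ i \<Longrightarrow> sp_mat M (\<lambda>s a. Q s a - T s a) \<le> 14 * \<epsilon>"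
      and m: "real m \<le> loop_bound \<epsilon> \<delta> i"
      by (auto simp: x good_run_def loop_bound_def)
    show "measure_pmf.prob (case x of (Q, T, \<pi>, m) \<Rightarrow>
        if sp_mat M (\<lambda>s a. Q s a - T s a) \<le> 14 * \<epsilon> then return_spmf (Q, T, \<pi>, N + m)
        else ?loop (i + 1) (N + m)) ?fail \<le> F"
    proof (cases "sp_mat M (\<lambda>s a. Q s a - T s a) \<le> 14 * \<epsilon>")
      case True
      then have "(Q, T, \<pi>, N + m) \<in> good_output pick \<epsilon> (real N + (loop_bound \<epsilon> \<delta> i + R))"
        using res m R by (simp add: good_output_def \<pi>)
      then show ?thesis using True F by (simp add: x)
    next
      case False
      then have "i \<noteq> I" using stop I by auto
      then have iI: "Suc i \<le> I" using less.prems by simp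
      \<comment> \<open>A good run draws at most \<open>loop_bound \<epsilon> \<delta> i\<close>
        samples, so the budget of the remaining loops fits into the current one.\<close>
      have "measure_pmf.prob (?loop (Suc i) (N + m)) ?fail
        \<le> measure_pmf.prob (?loop (Suc i) (N + m)) (- Some ` good_output pick \<epsilon> (real (N + m) + R))"
        using m by (intro measure_pmf.finite_measure_mono) (auto simp: good_output_def)
      also have "\<dots> \<le> F"
        unfolding R_def F_def by (rule less.hyps) (use iI in auto)
      finally show ?thesis using False by (simp add: x)
    qed
  qed
  also have "\<dots> \<le> \<delta> / c_seq i + F"
    by (intro add_right_mono savia_good_run[OF \<epsilon> \<delta>i]) (simp only: loop_alpha_def)
  finally show ?case
    unfolding R_def F_def sum.atLeast_Suc_atMost[OF less.prems] .
qed

text \<open>At most 9 \<open>log_factor \<epsilon>\<close> loops matter, each costing 11 * 10^9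
  times a rate with three such factors: 99 * 10^9 in all, with a fourth factor. The failure levels
  sum to at most \<delta>.\<close>

theorem savia_plus_success:
  assumes \<epsilon>: "0 < \<epsilon>" "\<epsilon> \<le> 1" and \<delta>: "0 < \<delta>" "\<delta> < 1"
  shows "1 - \<delta> \<le> measure (measure_spmf (savia_plus M c_seq \<beta>_seq pick (\<lambda>s a. 0) (\<epsilon> / 16) \<delta>))
    (good_output pick (\<epsilon> / 16) (10 ^ 11 * complexity_rate M H \<epsilon> \<delta>))"
proof -
  obtain I :: nat where I: "2 * H / (\<epsilon> / 16) \<le> 2 ^ I" "2 ^ I \<le> 64 * (H / \<epsilon>)"
    and card: "real (Suc I) \<le> 9 * log_factor \<epsilon>"
    using stopping_index[OF \<epsilon>] .
  let ?p = "savia_plus M c_seq \<beta>_seq pick (\<lambda>s a. 0) (\<epsilon> / 16) \<delta>"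
  let ?rate = "SA * (log_rate \<epsilon> \<delta> * log_factor \<epsilon> ^ 3 * (H / \<epsilon>)\<^sup>2)"
  have rate_nonneg: "0 \<le> ?rate"
    using SA_ge_1 log_rate_ge[OF \<epsilon> \<delta>] by (intro mult_nonneg_nonneg) (auto simp: log_factor_def)
  define B where "B = (\<Sum>j=0..I. loop_bound (\<epsilon> / 16) \<delta> j)"
  have "B \<le> (\<Sum>j=0..I. 11 * 10 ^ 9 * ?rate)"
    unfolding B_def
  proof (rule sum_mono)
    fix j assume "j \<in> {0..I}"
    then have "(2 :: real) ^ j \<le> 2 ^ I" by (intro power_increasing) auto
    then have "2 ^ j \<le> 64 * (H / \<epsilon>)" using I(2) by linarith
    from mult_left_mono[OF loop_samples_le[OF \<epsilon> \<delta> this], of SA] SA_ge_1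
    show "loop_bound (\<epsilon> / 16) \<delta> j \<le> 11 * 10 ^ 9 * ?rate"
      by (simp add: loop_bound_def mult_ac)
  qed
  also have "\<dots> = real (Suc I) * (11 * 10 ^ 9 * ?rate)" by simp
  also have "\<dots> \<le> 9 * log_factor \<epsilon> * (11 * 10 ^ 9 * ?rate)"
    using card rate_nonneg by (intro mult_right_mono) auto
  also have "\<dots> = (99 * 10 ^ 9) * (log_factor \<epsilon> * ?rate)" by simp
  also have "\<dots> \<le> 10 ^ 11 * (log_factor \<epsilon> * ?rate)"
    by (intro mult_right_mono mult_nonneg_nonneg[OF _ rate_nonneg]) (auto simp: log_factor_def)
  also have "log_factor \<epsilon> * ?rate = complexity_rate M H \<epsilon> \<delta>"
    by (simp add: complexity_rate_def Let_def SA_def log_rate_def log_factor_def power_divide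
        power4_eq_xxxx power3_eq_cube mult_ac)
  finally have B: "B \<le> 10 ^ 11 * complexity_rate M H \<epsilon> \<delta>" .
  have "measure_pmf.prob ?p (- Some ` good_output pick (\<epsilon> / 16) B) \<le> (\<Sum>j=0..I. \<delta> / c_seq j)"
    using savia_plus_loop_failure[of "\<epsilon> / 16" \<delta> I 0 pick 0, OF _ \<delta> I(1)] \<epsilon>
    by (simp add: savia_plus_def B_def)
  also have "\<dots> = \<delta> * (\<Sum>j<Suc I. 1 / c_seq j)"
    by (simp only: sum_distrib_left atLeast0AtMost lessThan_Suc_atMost) simp
  also have "\<dots> \<le> \<delta> * 1" using \<delta> by (intro mult_left_mono sum_inverse_c_seq_le) auto
  finally have "1 - \<delta> \<le> measure_pmf.prob ?p (Some ` good_output pick (\<epsilon> / 16) B)"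
    using measure_pmf.prob_compl[of "Some ` good_output pick (\<epsilon> / 16) B" ?p] by (simp add: Compl_eq_Diff_UNIV)
  also have "\<dots> = measure (measure_spmf ?p) (good_output pick (\<epsilon> / 16) B)"
    by (simp add: measure_measure_spmf_conv_measure_pmf space_measure_spmf)
  also have "\<dots> \<le> measure (measure_spmf ?p) (good_output pick (\<epsilon> / 16) (10 ^ 11 * complexity_rate M H \<epsilon> \<delta>))"
    using B by (intro finite_measure.finite_measure_mono) (auto simp: good_output_def)
  finally show ?thesis .
qed

end

text \<open>Only accuracy and sample count are probabilistic. The gain inequality holds for every Q
  and its greedy policy, and the running time is at most \<kappa> times the sample count.\<close>

theorem corollary3p5:
  "\<exists>C>0. \<forall>(M :: ('s, 'a) mdp) Qs pick cost \<kappa> \<epsilon> \<delta>.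
     finite_mdp M \<longrightarrow> weakly_communicating M \<longrightarrow>
     (\<forall>s\<in>states M. \<forall>a\<in>actions M. 0 \<le> reward M s a \<and> reward M s a \<le> 1) \<longrightarrow>
     bellman_solution M Qs \<longrightarrow>
     1 \<le> sp_state M (max_act M Qs) \<longrightarrow>
     (\<forall>Q. pick Q \<in> greedy_policies M Q) \<longrightarrow>
     (\<forall>j. 0 \<le> cost j \<and> cost j \<le> \<kappa>) \<longrightarrow>
     0 < \<epsilon> \<longrightarrow> \<epsilon> \<le> 1 \<longrightarrow> 0 < \<delta> \<longrightarrow> \<delta> < 1 \<longrightarrow>
     measure (measure_spmf (savia_plus M c_seq \<beta>_seq pick (\<lambda>s a. 0) (\<epsilon> / 16) \<delta>))
       {(Q, T, \<pi>, N).
          (\<forall>s\<in>states M.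
             opt_gain M s - gain M \<pi> s \<le> sp_mat M (\<lambda>s a. Q s a - bellman M Q s a)) \<and>
          sp_mat M (\<lambda>s a. Q s a - bellman M Q s a) \<le> \<epsilon> \<and>
          real N \<le> C * complexity_rate M (sp_state M (max_act M Qs)) \<epsilon> \<delta> \<and>
          run_time cost N \<le> C * \<kappa> * complexity_rate M (sp_state M (max_act M Qs)) \<epsilon> \<delta>}
       \<ge> 1 - \<delta>"
proof (rule exI[of _ "10 ^ 11"], intro conjI allI impI)
  fix M :: "('s, 'a) mdp" and Qs pick and cost :: "nat \<Rightarrow> real" and \<kappa> \<epsilon> \<delta> :: real
  assume mdp: "finite_mdp M" and wc: "weakly_communicating M"
    and reward: "\<forall>s\<in>states M. \<forall>a\<in>actions M. 0 \<le> reward M s a \<and> reward M s a \<le> 1"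
    and Qs: "bellman_solution M Qs" and sp: "1 \<le> sp_state M (max_act M Qs)"
    and pick: "\<forall>Q. pick Q \<in> greedy_policies M Q"
    and cost: "\<forall>j. 0 \<le> cost j \<and> cost j \<le> \<kappa>"
    and \<epsilon>: "0 < \<epsilon>" "\<epsilon> \<le> 1" and \<delta>: "0 < \<delta>" "\<delta> < 1"
  interpret mdp_context M by unfold_locales (rule mdp)
  obtain g where g: "\<forall>s\<in>states M. opt_gain M s = g" using opt_gain_constant[OF wc] by blast
  interpret savia_context M Qs g
    by unfold_locales (use reward Qs sp g in \<open>auto simp: bellman_solution_def\<close>)
  let ?rate = "complexity_rate M (sp_state M (max_act M Qs)) \<epsilon> \<delta>"
  have time: "run_time cost N \<le> 10 ^ 11 * \<kappa> * ?rate" if "real N \<le> 10 ^ 11 * ?rate" for N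
  proof -
    have "run_time cost N \<le> (\<Sum>j<N. \<kappa>)" unfolding run_time_def using cost by (intro sum_mono) auto
    also have "\<dots> = \<kappa> * real N" by simp
    also have "\<dots> \<le> \<kappa> * (10 ^ 11 * ?rate)"
      using that cost order_trans[of 0 "cost 0" \<kappa>] by (intro mult_left_mono) auto
    finally show ?thesis by (simp add: mult_ac)
  qed
  have "1 - \<delta> \<le> measure (measure_spmf (savia_plus M c_seq \<beta>_seq pick (\<lambda>s a. 0) (\<epsilon> / 16) \<delta>))
    (good_output pick (\<epsilon> / 16) (10 ^ 11 * ?rate))"
    using savia_plus_success[OF \<epsilon> \<delta>, of pick] by (simp only: H_def)
  also have "\<dots> \<le> measure (measure_spmf (savia_plus M c_seq \<beta>_seq pick (\<lambda>s a. 0) (\<epsilon> / 16) \<delta>))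
    {(Q, T, \<pi>, N).
          (\<forall>s\<in>states M.
             opt_gain M s - gain M \<pi> s \<le> sp_mat M (\<lambda>s a. Q s a - bellman M Q s a)) \<and>
          sp_mat M (\<lambda>s a. Q s a - bellman M Q s a) \<le> \<epsilon> \<and>
          real N \<le> 10 ^ 11 * ?rate \<and> run_time cost N \<le> 10 ^ 11 * \<kappa> * ?rate}"
  proof (intro finite_measure.finite_measure_mono finite_measure_spmf subsetI)
    fix x assume "x \<in> good_output pick (\<epsilon> / 16) (10 ^ 11 * ?rate)"
    then obtain Q T N where x: "x = (Q, T, pick Q, N)"
      and "sp_mat M (\<lambda>s a. Q s a - bellman M Q s a) \<le> \<epsilon>" and N: "real N \<le> 10 ^ 11 * ?rate"
      by (auto simp: good_output_def)
    then show "x \<in> {(Q, T, \<pi>, N).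
          (\<forall>s\<in>states M.
             opt_gain M s - gain M \<pi> s \<le> sp_mat M (\<lambda>s a. Q s a - bellman M Q s a)) \<and>
          sp_mat M (\<lambda>s a. Q s a - bellman M Q s a) \<le> \<epsilon> \<and>
          real N \<le> 10 ^ 11 * ?rate \<and> run_time cost N \<le> 10 ^ 11 * \<kappa> * ?rate}"
      using greedy_gain_gap pick time[OF N] by simp
  qed simp
  finally show "measure (measure_spmf (savia_plus M c_seq \<beta>_seq pick (\<lambda>s a. 0) (\<epsilon> / 16) \<delta>))
       {(Q, T, \<pi>, N).
          (\<forall>s\<in>states M.
             opt_gain M s - gain M \<pi> s \<le> sp_mat M (\<lambda>s a. Q s a - bellman M Q s a)) \<and>
          sp_mat M (\<lambda>s a. Q s a - bellman M Q s a) \<le> \<epsilon> \<and>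
          real N \<le> 10 ^ 11 * ?rate \<and> run_time cost N \<le> 10 ^ 11 * \<kappa> * ?rate}
       \<ge> 1 - \<delta>" .
qed simp

end
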